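(* Let $f(X_1,\ldots,X_n):=\sum_{k=0}^\infty\sum_{|\alpha|=k}a_\alpha X_\alpha$, $a_\alpha\in\mathbb{C}$, be a (universal) holomorphic function on $[B(\mathcal{X})^n]_{<1}$ such that $f(0)\geq0$ and $$\mathrm{Re}\,f(X_1,\ldots,X_n)\leq I\quad\text{for any }(X_1,\ldots,X_n)\in[B(\mathcal{X})^n]_{<1}\text{ and any Hilbert space }\mathcal{X}.$$ Then $$\left(\sum_{|\alpha|=k}|a_\alpha|^2\right)^{1/2}\leq2(1-a_0)\quad\text{for }k=1,2,\ldots,$$ where $a_0:=a_{g_0}$, and $$\sum_{k=0}^\infty\left\|\sum_{|\alpha|=k}|a_\alpha|T_\alpha\right\|\leq1$$ for any Hilbert space $\mathcal{K}$ and any $(T_1,\ldots,T_n)\in[B(\mathcal{K})^n]_{1/3}$. In particular, $\sum_{\alpha\in\mathbb{F}_n^+}|a_\alpha|r_\alpha\leq1$ for any $r:=(r_1,\ldots,r_n)$ with $r_1\geq0,\ldots,r_n\geq0$ and $\|r\|_2\leq\frac13$.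
   Context: $\mathbb{F}_n^+$ is the unital free semigroup on generators $g_1,\dots,g_n$ with identity $g_0$; $|g_{i_1}\cdots g_{i_k}|=k$, $|g_0|=0$. For operators (or scalars) $T_1,\dots,T_n$ and $\alpha=g_{i_1}\cdots g_{i_k}$, $T_\alpha:=T_{i_1}\cdots T_{i_k}$, $T_{g_0}:=I$. For a Hilbert space $\mathcal{X}$, $[B(\mathcal{X})^n]_{<1}:=\{(X_1,\ldots,X_n)\in B(\mathcal{X})^n:\|X_1X_1^*+\cdots+X_nX_n^*\|<1\}$, and for $r\ge0$, $[B(\mathcal{K})^n]_r:=\{(T_1,\ldots,T_n):\|T_1T_1^*+\cdots+T_nT_n^*\|^{1/2}\le r\}$. A family $\{a_\alpha\}_{\alpha\in\mathbb{F}_n^+}\subset\mathbb{C}$ defines a (universal) holomorphic function $f$ on $[B(\mathcal{X})^n]_{<1}$ if $\sum_{k=0}^\infty\left(\sum_{|\alpha|=k}a_\alpha X_\alpha\right)$ converges in norm for every Hilbert space $\mathcal{X}$ and every $(X_1,\ldots,X_n)\in[B(\mathcal{X})^n]_{<1}$. $f(0)=a_{g_0}$; $\mathrm{Re}\,A=\frac12(A+A^* )$; $\|\cdot\|_2$ is the Euclidean norm. *)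

theory Defs
  imports "HOL-Analysis.Analysis" "HOL-Algebra.Algebraic_Closure_Type"
begin

section \<open>Complex Hilbert spaces with explicit carriers\<close>

text \<open>
  Hilbert spaces are structures with a carrier set, not a type class, because the theorem has
  hypotheses quantified over Hilbert spaces. The fields \<open>mult\<close> and \<open>one\<close>, which HOL-Algebra's
  module record inherits from \<open>ring\<close>, play no role. The inner product is linear in its first
  argument.
\<close>

record 'a hilbert = "(complex, 'a) module" +
  cinner :: "'a \<Rightarrow> 'a \<Rightarrow> complex"

definition hnorm :: "'a hilbert \<Rightarrow> 'a \<Rightarrow> real" where
  "hnorm H x = sqrt (Re (cinner H x x))"

locale hilbert_space = Module.module "ring_of_type_algebra :: complex ring" H
  for H :: "'a hilbert" (structure) +
  assumes cinner_add_left: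
      "\<lbrakk>x \<in> carrier H; y \<in> carrier H; z \<in> carrier H\<rbrakk>
        \<Longrightarrow> cinner H (x \<oplus> y) z = cinner H x z + cinner H y z"
    and cinner_smult_left:
      "\<lbrakk>x \<in> carrier H; y \<in> carrier H\<rbrakk> \<Longrightarrow> cinner H (c \<odot>\<^bsub>H\<^esub> x) y = c * cinner H x y"
    and cinner_commute:
      "\<lbrakk>x \<in> carrier H; y \<in> carrier H\<rbrakk> \<Longrightarrow> cinner H x y = cnj (cinner H y x)"
    and cinner_nonneg: "x \<in> carrier H \<Longrightarrow> 0 \<le> Re (cinner H x x)"
    and cinner_definite: "\<lbrakk>x \<in> carrier H; cinner H x x = 0\<rbrakk> \<Longrightarrow> x = \<zero>"
    and complete:
      "\<lbrakk>\<And>m. s m \<in> carrier H;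
        \<forall>e>0. \<exists>N. \<forall>m\<ge>N. \<forall>k\<ge>N. hnorm H (s m \<ominus> s k) < e\<rbrakk>
        \<Longrightarrow> \<exists>l\<in>carrier H. (\<lambda>m. hnorm H (s m \<ominus> l)) \<longlonglongrightarrow> 0"

text \<open>
  The carrier type over which the hypotheses of the theorem range. Every Hilbert space of
  cardinality at most the continuum, in particular every separable one, has an isomorphic copy
  whose carrier is a set of elements of this type. HOL cannot quantify over all types inside a
  hypothesis; as the restriction occurs only in hypotheses, it makes the theorem stronger.
\<close>

type_synonym universe = "nat \<Rightarrow> complex"

section \<open>Bounded operators\<close>

text \<open>Operators are functions of which only the values on the carrier matter.\<close>

definition bounded_ops :: "'a hilbert \<Rightarrow> ('a \<Rightarrow> 'a) set" where
  "bounded_ops H = {T. T \<in> carrier H \<rightarrow> carrier H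
     \<and> (\<forall>x\<in>carrier H. \<forall>y\<in>carrier H. T (x \<oplus>\<^bsub>H\<^esub> y) = T x \<oplus>\<^bsub>H\<^esub> T y)
     \<and> (\<forall>c. \<forall>x\<in>carrier H. T (c \<odot>\<^bsub>H\<^esub> x) = c \<odot>\<^bsub>H\<^esub> T x)
     \<and> (\<exists>C. \<forall>x\<in>carrier H. hnorm H (T x) \<le> C * hnorm H x)}"

definition op_norm :: "'a hilbert \<Rightarrow> ('a \<Rightarrow> 'a) \<Rightarrow> real" where
  "op_norm H T = Sup {hnorm H (T x) |x. x \<in> carrier H \<and> hnorm H x \<le> 1}"

definition op_add :: "'a hilbert \<Rightarrow> ('a \<Rightarrow> 'a) \<Rightarrow> ('a \<Rightarrow> 'a) \<Rightarrow> 'a \<Rightarrow> 'a" where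
  "op_add H S T = (\<lambda>x. S x \<oplus>\<^bsub>H\<^esub> T x)"

definition op_diff :: "'a hilbert \<Rightarrow> ('a \<Rightarrow> 'a) \<Rightarrow> ('a \<Rightarrow> 'a) \<Rightarrow> 'a \<Rightarrow> 'a" where
  "op_diff H S T = (\<lambda>x. S x \<ominus>\<^bsub>H\<^esub> T x)"

definition op_scale :: "'a hilbert \<Rightarrow> complex \<Rightarrow> ('a \<Rightarrow> 'a) \<Rightarrow> 'a \<Rightarrow> 'a" where
  "op_scale H c T = (\<lambda>x. c \<odot>\<^bsub>H\<^esub> T x)"

definition op_sum :: "'a hilbert \<Rightarrow> ('i \<Rightarrow> 'a \<Rightarrow> 'a) \<Rightarrow> 'i set \<Rightarrow> 'a \<Rightarrow> 'a" where
  "op_sum H F A = (\<lambda>x. finsum H (\<lambda>i. F i x) A)"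

definition adjoint_op :: "'a hilbert \<Rightarrow> ('a \<Rightarrow> 'a) \<Rightarrow> 'a \<Rightarrow> 'a" where
  "adjoint_op H T y =
     (THE z. z \<in> carrier H \<and> (\<forall>x\<in>carrier H. cinner H (T x) y = cinner H x z))"

definition Re_op :: "'a hilbert \<Rightarrow> ('a \<Rightarrow> 'a) \<Rightarrow> 'a \<Rightarrow> 'a" where
  "Re_op H A = op_scale H (1/2) (op_add H A (adjoint_op H A))"

definition op_le :: "'a hilbert \<Rightarrow> ('a \<Rightarrow> 'a) \<Rightarrow> ('a \<Rightarrow> 'a) \<Rightarrow> bool" where
  "op_le H A B \<longleftrightarrow>
     (\<forall>x\<in>carrier H. cinner H (op_diff H B A x) x \<in> \<real> \<and> 0 \<le> Re (cinner H (op_diff H B A x) x))"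

section \<open>Tuples of operators and free holomorphic functions\<close>

text \<open>
  The generators are the elements of a finite type \<open>'n\<close>, with \<open>n = CARD('n)\<close>. Words of the free
  semigroup are lists over \<open>'n\<close>, the identity being the empty list.
\<close>

definition word_op :: "('n \<Rightarrow> 'a \<Rightarrow> 'a) \<Rightarrow> 'n list \<Rightarrow> 'a \<Rightarrow> 'a" where
  "word_op T \<alpha> = foldr (\<lambda>i S. T i \<circ> S) \<alpha> id"

definition row_square :: "'a hilbert \<Rightarrow> ('n::finite \<Rightarrow> 'a \<Rightarrow> 'a) \<Rightarrow> 'a \<Rightarrow> 'a" where
  "row_square H T = op_sum H (\<lambda>i. T i \<circ> adjoint_op H (T i)) UNIV"

definition row_ball :: "'a hilbert \<Rightarrow> ('n::finite \<Rightarrow> 'a \<Rightarrow> 'a) set" where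
  "row_ball H = {Z. (\<forall>i. Z i \<in> bounded_ops H) \<and> op_norm H (row_square H Z) < 1}"

definition row_cball :: "'a hilbert \<Rightarrow> real \<Rightarrow> ('n::finite \<Rightarrow> 'a \<Rightarrow> 'a) set" where
  "row_cball H r = {T. (\<forall>i. T i \<in> bounded_ops H) \<and> sqrt (op_norm H (row_square H T)) \<le> r}"

definition homogeneous_part ::
  "'a hilbert \<Rightarrow> ('n::finite list \<Rightarrow> complex) \<Rightarrow> ('n \<Rightarrow> 'a \<Rightarrow> 'a) \<Rightarrow> nat \<Rightarrow> 'a \<Rightarrow> 'a" where
  "homogeneous_part H a Z k = op_sum H (\<lambda>\<alpha>. op_scale H (a \<alpha>) (word_op Z \<alpha>)) {\<alpha>. length \<alpha> = k}"

definition free_series_sums ::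
  "'a hilbert \<Rightarrow> ('n::finite list \<Rightarrow> complex) \<Rightarrow> ('n \<Rightarrow> 'a \<Rightarrow> 'a) \<Rightarrow> ('a \<Rightarrow> 'a) \<Rightarrow> bool" where
  "free_series_sums H a Z L \<longleftrightarrow> L \<in> bounded_ops H \<and>
     (\<lambda>N. op_norm H (op_diff H (op_sum H (homogeneous_part H a Z) {..<N}) L)) \<longlonglongrightarrow> 0"

definition free_holomorphic :: "'a hilbert \<Rightarrow> ('n::finite list \<Rightarrow> complex) \<Rightarrow> bool" where
  "free_holomorphic H a \<longleftrightarrow> (\<forall>Z\<in>row_ball H. \<exists>L. free_series_sums H a Z L)"

text \<open>The limit is unique as an operator, that is, up to its values outside the carrier.\<close>

definition free_eval ::
  "'a hilbert \<Rightarrow> ('n::finite list \<Rightarrow> complex) \<Rightarrow> ('n \<Rightarrow> 'a \<Rightarrow> 'a) \<Rightarrow> 'a \<Rightarrow> 'a" where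
  "free_eval H a Z = (SOME L. free_series_sums H a Z L)"

end

theory Submission
  imports Defs
begin

text \<open>
  Test the hypothesis on the truncation of the full Fock space to words of length at most \<open>k\<close>, at
  \<open>r\<close> times the creation operators. On the vector with component \<open>c\<close> at the empty word and
  \<open>a w\<close> at the words of length \<open>k\<close> it reads, as \<open>r \<longrightarrow> 1\<close>,
  \<open>a\<^sub>0 (c\<^sup>2 + A\<^sup>2) + c A\<^sup>2 \<le> c\<^sup>2 + A\<^sup>2\<close> with \<open>A\<^sup>2 = \<Sum>\<bar>a w\<bar>\<^sup>2\<close>; the choice \<open>c = A\<close> gives
  \<open>A \<le> 2 (1 - a\<^sub>0)\<close>. The words of length \<open>k\<close> in a row operator of norm \<open>\<rho>\<close> form a row operator of
  norm at most \<open>\<rho>\<^sup>k\<close>, so the Cauchy--Schwarz inequality bounds the \<open>k\<close>-th homogeneous part by \<open>A \<rho>\<^sup>k\<close>,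
  and for \<open>\<rho> \<le> 1/3\<close> these bounds add up to at most \<open>a\<^sub>0 + 2 (1 - a\<^sub>0) \<Sum>\<^bsub>k\<ge>1\<^esub> 3\<^sup>-\<^sup>k = 1\<close>.
\<close>

section \<open>Words of fixed length\<close>

lemma finite_words [simp]: "finite {\<alpha> :: 'n::finite list. length \<alpha> = k}"
  using finite_lists_length_eq[of "UNIV :: 'n set" k] by simp

text \<open>Splitting off the first letter drives every induction on word length below, for
  operators and for scalars alike.\<close>

lemma sum_words_Suc:
  fixes f :: "'n::finite list \<Rightarrow> 'b::comm_monoid_add"
  shows "(\<Sum>\<alpha> | length \<alpha> = Suc k. f \<alpha>) = (\<Sum>i\<in>UNIV. \<Sum>\<beta> | length \<beta> = k. f (i # \<beta>))"
proof -
  have "{\<alpha> :: 'n list. length \<alpha> = Suc k} = (\<lambda>(i, \<beta>). i # \<beta>) ` (UNIV \<times> {\<beta>. length \<beta> = k})"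
    by (auto simp: length_Suc_conv)
  moreover have "inj_on (\<lambda>(i, \<beta>). i # \<beta>) (UNIV \<times> {\<beta> :: 'n list. length \<beta> = k})"
    by (auto simp: inj_on_def)
  ultimately show ?thesis
    by (simp add: sum.reindex sum.cartesian_product case_prod_unfold o_def)
qed

lemma sum_mult_le_sqrt:
  fixes u v :: "'i \<Rightarrow> real"
  shows "(\<Sum>i\<in>A. u i * v i) \<le> sqrt (\<Sum>i\<in>A. (u i)\<^sup>2) * sqrt (\<Sum>i\<in>A. (v i)\<^sup>2)"
proof -
  have "(\<Sum>i\<in>A. u i * v i) \<le> (\<Sum>i\<in>A. \<bar>u i\<bar> * \<bar>v i\<bar>)"
    by (intro sum_mono) (metis abs_ge_self abs_mult)
  then show ?thesis
    using L2_set_mult_ineq[of u v A] unfolding L2_set_def by linarith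
qed

section \<open>Operators on Hilbert spaces\<close>

context hilbert_space
begin

section \<open>Inner product geometry up to Cauchy-Schwarz and the triangle inequality\<close>

lemma smult_closed_complex [simp, intro]: "x \<in> carrier H \<Longrightarrow> c \<odot>\<^bsub>H\<^esub> x \<in> carrier H"
  using smult_closed[of c x] by (simp add: ring_of_type_algebra_def)

lemma cinner_add_right:
  "\<lbrakk>x \<in> carrier H; y \<in> carrier H; z \<in> carrier H\<rbrakk>
    \<Longrightarrow> cinner H z (x \<oplus> y) = cinner H z x + cinner H z y"
  by (metis M.a_closed cinner_add_left cinner_commute complex_cnj_add)

lemma cinner_smult_right:
  "\<lbrakk>x \<in> carrier H; y \<in> carrier H\<rbrakk> \<Longrightarrow> cinner H y (c \<odot>\<^bsub>H\<^esub> x) = cnj c * cinner H y x"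
  by (metis smult_closed_complex cinner_commute cinner_smult_left complex_cnj_mult)

lemma cinner_zero_left [simp]: "x \<in> carrier H \<Longrightarrow> cinner H \<zero> x = 0"
  using cinner_add_left[of \<zero> \<zero> x] by simp

lemma cinner_zero_right [simp]: "x \<in> carrier H \<Longrightarrow> cinner H x \<zero> = 0"
  using cinner_add_right[of \<zero> \<zero> x] by simp

lemma cinner_minus_left:
  "\<lbrakk>x \<in> carrier H; y \<in> carrier H\<rbrakk> \<Longrightarrow> cinner H (\<ominus> x) y = - cinner H x y"
  using cinner_add_left[of "\<ominus> x" x y] by (simp add: M.l_neg add_eq_0_iff2)

lemma cinner_diff_left:
  "\<lbrakk>x \<in> carrier H; y \<in> carrier H; z \<in> carrier H\<rbrakk>
    \<Longrightarrow> cinner H (x \<ominus> y) z = cinner H x z - cinner H y z"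
  by (simp add: a_minus_def cinner_add_left cinner_minus_left)

lemma cinner_diff_right:
  "\<lbrakk>x \<in> carrier H; y \<in> carrier H; z \<in> carrier H\<rbrakk>
    \<Longrightarrow> cinner H z (x \<ominus> y) = cinner H z x - cinner H z y"
  by (metis M.minus_closed cinner_diff_left cinner_commute complex_cnj_diff)

lemmas cinner_simps =
  cinner_add_left cinner_add_right cinner_smult_left cinner_smult_right
  cinner_diff_left cinner_diff_right

lemma cinner_finsum_left:
  assumes "finite A" "f \<in> A \<rightarrow> carrier H" "y \<in> carrier H"
  shows "cinner H (finsum H f A) y = (\<Sum>i\<in>A. cinner H (f i) y)"
  using assms
proof (induction A)
  case (insert i A)
  then have "finsum H f A \<in> carrier H"
    by (intro M.finsum_closed) auto
  with insert show ?case
    by (simp add: Pi_def cinner_add_left)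
qed simp

text \<open>Vectors are separated by their inner products. Later vector identities are reduced in
  this way to complex arithmetic by \<open>cinner_simps\<close>.\<close>

lemma cinner_ext:
  assumes "x \<in> carrier H" "y \<in> carrier H"
    and "\<And>z. z \<in> carrier H \<Longrightarrow> cinner H z x = cinner H z y"
  shows "x = y"
proof -
  have "cinner H (x \<ominus> y) (x \<ominus> y) = 0"
    using assms by (simp add: cinner_diff_right)
  then have "x \<ominus> y = \<zero>"
    using assms(1,2) cinner_definite by simp
  then have "\<ominus> (\<ominus> y) = x"
    using assms(1,2) by (intro M.minus_equality) (simp_all add: M.minus_eq)
  then show ?thesis
    using assms(2) by simp
qed

lemma cinner_self_real: "x \<in> carrier H \<Longrightarrow> Im (cinner H x x) = 0"
  using arg_cong[OF cinner_commute[of x x], of Im] by simp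

lemma hnorm_nonneg [simp]: "x \<in> carrier H \<Longrightarrow> 0 \<le> hnorm H x"
  by (simp add: hnorm_def cinner_nonneg)

lemma hnorm_sq: "x \<in> carrier H \<Longrightarrow> (hnorm H x)\<^sup>2 = Re (cinner H x x)"
  by (simp add: hnorm_def cinner_nonneg)

lemma cinner_self: "x \<in> carrier H \<Longrightarrow> cinner H x x = of_real ((hnorm H x)\<^sup>2)"
  by (simp add: hnorm_sq complex_eq_iff cinner_self_real)

lemma hnorm_zero [simp]: "hnorm H \<zero> = 0"
  by (simp add: hnorm_def)

lemma hnorm_eq_0: "\<lbrakk>x \<in> carrier H; hnorm H x = 0\<rbrakk> \<Longrightarrow> x = \<zero>"
  using cinner_definite cinner_self by simp

lemma hnorm_smult: "x \<in> carrier H \<Longrightarrow> hnorm H (c \<odot>\<^bsub>H\<^esub> x) = cmod c * hnorm H x"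
proof -
  assume x: "x \<in> carrier H"
  have "cinner H (c \<odot>\<^bsub>H\<^esub> x) (c \<odot>\<^bsub>H\<^esub> x) = (c * cnj c) * cinner H x x"
    using x by (simp add: cinner_simps)
  also have "\<dots> = of_real ((cmod c * hnorm H x)\<^sup>2)"
    using x by (simp add: cinner_self complex_norm_square[symmetric] power_mult_distrib)
  finally have "(hnorm H (c \<odot>\<^bsub>H\<^esub> x))\<^sup>2 = (cmod c * hnorm H x)\<^sup>2"
    using x by (simp add: hnorm_sq del: of_real_power)
  then show ?thesis
    using x by (simp add: power2_eq_iff_nonneg)
qed

lemma cauchy_schwarz:
  assumes x: "x \<in> carrier H" and y: "y \<in> carrier H"
  shows "cmod (cinner H x y) \<le> hnorm H x * hnorm H y"
proof (cases "hnorm H y = 0")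
  case True
  then show ?thesis
    using hnorm_eq_0[OF y] x by simp
next
  case False
  define b where "b = cinner H x y"
  \<comment> \<open>\<open>c\<close> is the coefficient of the orthogonal projection of
    \<open>x\<close> onto the line through \<open>y\<close>; the inequality is the nonnegativity of
    the squared norm of the remainder.\<close>
  define c where "c = b / of_real ((hnorm H y)\<^sup>2)"
  have c: "c * of_real ((hnorm H y)\<^sup>2) = b"
    using False by (simp add: c_def)
  have "cinner H (x \<ominus> c \<odot>\<^bsub>H\<^esub> y) (x \<ominus> c \<odot>\<^bsub>H\<^esub> y)
      = cinner H x x - cnj c * b - c * cnj b + c * cnj c * cinner H y y"
    using x y cinner_commute[OF y x] by (simp add: cinner_simps b_def algebra_simps)
  also have "c * cnj c * cinner H y y = cnj c * (c * of_real ((hnorm H y)\<^sup>2))"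
    using y by (simp add: cinner_self)
  also have "\<dots> = cnj c * b"
    by (simp only: c)
  finally have "cinner H (x \<ominus> c \<odot>\<^bsub>H\<^esub> y) (x \<ominus> c \<odot>\<^bsub>H\<^esub> y) = of_real ((hnorm H x)\<^sup>2) - c * cnj b"
    using x by (simp add: cinner_self)
  moreover have "c * cnj b = of_real ((cmod b)\<^sup>2 / (hnorm H y)\<^sup>2)"
    by (simp add: c_def complex_norm_square[symmetric])
  ultimately have "Re (cinner H (x \<ominus> c \<odot>\<^bsub>H\<^esub> y) (x \<ominus> c \<odot>\<^bsub>H\<^esub> y))
      = (hnorm H x)\<^sup>2 - (cmod b)\<^sup>2 / (hnorm H y)\<^sup>2"
    by simp
  then have "(cmod b)\<^sup>2 / (hnorm H y)\<^sup>2 \<le> (hnorm H x)\<^sup>2"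
    using cinner_nonneg[of "x \<ominus> c \<odot>\<^bsub>H\<^esub> y"] x y by simp
  then have "(cmod b)\<^sup>2 \<le> (hnorm H x * hnorm H y)\<^sup>2"
    using False by (simp add: divide_simps power_mult_distrib split: if_splits)
  then show ?thesis
    unfolding b_def by (rule power2_le_imp_le) (use x y in simp)
qed

lemma hnorm_add_le:
  assumes x: "x \<in> carrier H" and y: "y \<in> carrier H"
  shows "hnorm H (x \<oplus> y) \<le> hnorm H x + hnorm H y"
proof (rule power2_le_imp_le)
  have "(hnorm H (x \<oplus> y))\<^sup>2 = (hnorm H x)\<^sup>2 + (hnorm H y)\<^sup>2 + 2 * Re (cinner H x y)"
    using x y cinner_commute[OF x y] by (simp add: hnorm_sq cinner_simps)
  also have "\<dots> \<le> (hnorm H x)\<^sup>2 + (hnorm H y)\<^sup>2 + 2 * (hnorm H x * hnorm H y)"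
    using cauchy_schwarz[OF x y] complex_Re_le_cmod[of "cinner H x y"] by linarith
  finally show "(hnorm H (x \<oplus> y))\<^sup>2 \<le> (hnorm H x + hnorm H y)\<^sup>2"
    by (simp add: power2_sum)
qed (use x y in simp)

subsection \<open>Riesz representation\<close>

text \<open>
  The representing vector minimises \<open>J\<close>; minimising sequences are Cauchy by the parallelogram
  law, so no orthogonal complements are needed.
\<close>

lemma riesz:
  assumes add: "\<And>x y. \<lbrakk>x \<in> carrier H; y \<in> carrier H\<rbrakk> \<Longrightarrow> \<phi> (x \<oplus> y) = \<phi> x + \<phi> y"
    and scale: "\<And>c x. x \<in> carrier H \<Longrightarrow> \<phi> (c \<odot>\<^bsub>H\<^esub> x) = c * \<phi> x"
    and bdd: "\<And>x. x \<in> carrier H \<Longrightarrow> cmod (\<phi> x) \<le> C * hnorm H x"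
  shows "\<exists>z\<in>carrier H. \<forall>x\<in>carrier H. \<phi> x = cinner H x z"
proof -
  define J where "J x = (hnorm H x)\<^sup>2 - 2 * Re (\<phi> x)" for x
  define m where "m = Inf (J ` carrier H)"
  \<comment> \<open>Completing the square in \<open>hnorm H x\<close> bounds \<open>J\<close> from
    below, so that the infimum \<open>m\<close> is meaningful.\<close>
  have "- C\<^sup>2 \<le> J x" if "x \<in> carrier H" for x
  proof -
    have "Re (\<phi> x) \<le> C * hnorm H x"
      using bdd[OF that] complex_Re_le_cmod[of "\<phi> x"] by linarith
    moreover have "0 \<le> (hnorm H x - C)\<^sup>2"
      by simp
    ultimately show ?thesis
      by (simp add: J_def power2_diff mult.commute)
  qed
  then have bb: "bdd_below (J ` carrier H)"
    by (rule bdd_belowI2)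
  then have m_le: "m \<le> J x" if "x \<in> carrier H" for x
    unfolding m_def using that by (intro cInf_lower) auto
  have "\<exists>x\<in>carrier H. J x < m + inverse (Suc n)" for n
  proof -
    have "\<exists>v\<in>J ` carrier H. v < m + inverse (Suc n)"
      using cInf_lessD[of "J ` carrier H" "m + inverse (Suc n)"] M.zero_closed by (force simp: m_def)
    then show ?thesis
      by auto
  qed
  then obtain s where s: "\<And>n. s n \<in> carrier H" and Js: "\<And>n. J (s n) < m + inverse (Suc n)"
    by metis
  \<comment> \<open>The parallelogram law; the contributions of \<phi> cancel by linearity.\<close>
  have para: "(hnorm H (x \<ominus> y))\<^sup>2 = 2 * J x + 2 * J y - 4 * J ((1/2) \<odot>\<^bsub>H\<^esub> (x \<oplus> y))"
    if "x \<in> carrier H" "y \<in> carrier H" for x y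
    using that by (simp add: J_def hnorm_sq cinner_simps add scale algebra_simps)
  have cauchy: "\<forall>e>0. \<exists>N. \<forall>k\<ge>N. \<forall>l\<ge>N. hnorm H (s k \<ominus> s l) < e"
  proof (intro allI impI)
    fix e :: real assume e: "e > 0"
    \<comment> \<open>Both values of \<open>J\<close> exceed \<open>m\<close> by less than
      \<open>inverse (Suc N)\<close> and the midpoint has value at least \<open>m\<close>, so
      \<open>para\<close> bounds the squared distance by four times this number.\<close>
    obtain N where N: "inverse (real (Suc N)) < e\<^sup>2 / 4"
      using reals_Archimedean[of "e\<^sup>2 / 4"] e by auto
    have "hnorm H (s k \<ominus> s l) < e" if "k \<ge> N" "l \<ge> N" for k l
    proof -
      have "inverse (real (Suc k)) \<le> inverse (real (Suc N))"
        "inverse (real (Suc l)) \<le> inverse (real (Suc N))"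
        using that by (auto intro!: le_imp_inverse_le)
      moreover have "m \<le> J ((1/2) \<odot>\<^bsub>H\<^esub> (s k \<oplus> s l))"
        by (rule m_le) (simp add: s)
      ultimately have "(hnorm H (s k \<ominus> s l))\<^sup>2 < e\<^sup>2"
        using para[OF s s, of k l] Js[of k] Js[of l] N by linarith
      then show ?thesis
        using e by (intro power2_less_imp_less[of _ e]) auto
    qed
    then show "\<exists>N. \<forall>k\<ge>N. \<forall>l\<ge>N. hnorm H (s k \<ominus> s l) < e"
      by blast
  qed
  obtain z where z: "z \<in> carrier H" and lim: "(\<lambda>n. hnorm H (s n \<ominus> z)) \<longlonglongrightarrow> 0"
    using complete[OF s cauchy] by blast
  have Jz: "J z \<le> m"
  \<comment> \<open>Expanding \<open>J\<close> around \<open>z\<close> controls \<open>J z\<close>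
    by \<open>J (s n)\<close> and an error linear in the distance to \<open>s n\<close>, which
    vanishes in the limit.\<close>
  proof -
    define d where "d n = s n \<ominus> z" for n
    have d: "d n \<in> carrier H" for n
      using s z by (simp add: d_def)
    have "J z \<le> m + inverse (Suc n) + 2 * (hnorm H z + C) * hnorm H (d n)" for n
    proof -
      have sn: "s n = z \<oplus> d n"
        unfolding d_def using s z by (intro cinner_ext) (simp_all add: cinner_simps)
      have "J (s n) = J z + (hnorm H (d n))\<^sup>2 + 2 * Re (cinner H z (d n)) - 2 * Re (\<phi> (d n))"
        unfolding sn J_def using z d[of n] cinner_commute[OF z d[of n]]
        by (simp add: hnorm_sq cinner_simps add)
      moreover have "\<bar>Re (cinner H z (d n))\<bar> \<le> hnorm H z * hnorm H (d n)"
        using cauchy_schwarz[OF z d] abs_Re_le_cmod order_trans by blast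
      moreover have "\<bar>Re (\<phi> (d n))\<bar> \<le> C * hnorm H (d n)"
        using bdd[OF d] abs_Re_le_cmod order_trans by blast
      moreover have "2 * (hnorm H z + C) * hnorm H (d n)
          = 2 * (hnorm H z * hnorm H (d n)) + 2 * (C * hnorm H (d n))"
        by (simp add: algebra_simps)
      ultimately show ?thesis
        using Js[of n] zero_le_power2[of "hnorm H (d n)"] by linarith
    qed
    moreover have "(\<lambda>n. m + inverse (real (Suc n)) + 2 * (hnorm H z + C) * hnorm H (d n))
        \<longlonglongrightarrow> m + 0 + 2 * (hnorm H z + C) * 0"
      unfolding d_def by (intro tendsto_intros lim LIMSEQ_inverse_real_of_nat)
    ultimately have "J z \<le> m + 0 + 2 * (hnorm H z + C) * 0"
      by (intro LIMSEQ_le_const) auto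
    then show ?thesis
      by simp
  qed
  have Re_eq: "Re (\<phi> x) = Re (cinner H x z)" if x: "x \<in> carrier H" for x
  proof -
    define b where "b = Re (cinner H x z) - Re (\<phi> x)"
    \<comment> \<open>The variation of \<open>J\<close> from its minimiser \<open>z\<close> in the
      direction \<open>x\<close> is nonnegative; its linear coefficient \<open>b\<close> must
      therefore vanish.\<close>
    have quad: "0 \<le> t\<^sup>2 * (hnorm H x)\<^sup>2 + 2 * t * b" for t :: real
    proof -
      have "J (z \<oplus> of_real t \<odot>\<^bsub>H\<^esub> x) = J z + t\<^sup>2 * (hnorm H x)\<^sup>2 + 2 * t * b"
        using x z cinner_commute[OF z x]
        by (simp add: J_def b_def hnorm_sq cinner_simps add scale power2_eq_square[of t] algebra_simps)
      then show ?thesis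
        using m_le[of "z \<oplus> of_real t \<odot>\<^bsub>H\<^esub> x"] Jz x z by simp
    qed
    \<comment> \<open>The added 1 keeps \<open>q\<close> positive even for \<open>x = 0\<close>; at
      \<open>t = - b / q\<close> the quadratic is a sum of two nonpositive terms.\<close>
    define q where "q = (hnorm H x)\<^sup>2 + 1"
    have q: "q > 0" "(hnorm H x)\<^sup>2 = q - 1"
      by (auto simp: q_def add_nonneg_pos)
    have "0 \<le> (b / q)\<^sup>2 * (q - 1) - 2 * b\<^sup>2 / q"
      using quad[of "- b / q"] q by (simp add: power2_eq_square)
    also have "\<dots> = - (b\<^sup>2 / q) - (b / q)\<^sup>2"
      using q by (simp add: field_simps power2_eq_square)
    finally have "b\<^sup>2 / q \<le> 0"
      using zero_le_power2[of "b / q"] by linarith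
    then have "b = 0"
      using q by (simp add: divide_le_0_iff)
    then show ?thesis
      by (simp add: b_def)
  qed
  \<comment> \<open>Applying the real identity to \<i> times \<open>x\<close> gives the imaginary
    parts.\<close>
  have "\<phi> x = cinner H x z" if x: "x \<in> carrier H" for x
    using Re_eq[OF x] Re_eq[of "\<i> \<odot>\<^bsub>H\<^esub> x"] x z by (simp add: complex_eq_iff scale cinner_simps)
  with z show ?thesis
    by blast
qed

subsection \<open>Bounded operators\<close>

lemma Re_cinner_le:
  "\<lbrakk>x \<in> carrier H; y \<in> carrier H\<rbrakk> \<Longrightarrow> Re (cinner H x y) \<le> hnorm H x * hnorm H y"
  by (rule order_trans[OF complex_Re_le_cmod cauchy_schwarz])

lemma smult_zero: "c \<odot>\<^bsub>H\<^esub> \<zero> = \<zero>"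
  by (rule cinner_ext) (simp_all add: cinner_smult_right)

lemma bounded_opsI:
  assumes "\<And>x. x \<in> carrier H \<Longrightarrow> T x \<in> carrier H"
    and "\<And>x y. \<lbrakk>x \<in> carrier H; y \<in> carrier H\<rbrakk> \<Longrightarrow> T (x \<oplus> y) = T x \<oplus> T y"
    and "\<And>c x. x \<in> carrier H \<Longrightarrow> T (c \<odot>\<^bsub>H\<^esub> x) = c \<odot>\<^bsub>H\<^esub> T x"
    and "\<And>x. x \<in> carrier H \<Longrightarrow> hnorm H (T x) \<le> C * hnorm H x"
  shows "T \<in> bounded_ops H"
  unfolding bounded_ops_def using assms by (auto intro!: exI[of _ C])

lemma
  assumes "T \<in> bounded_ops H"
  shows bounded_ops_closed: "x \<in> carrier H \<Longrightarrow> T x \<in> carrier H"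
    and bounded_ops_add: "\<lbrakk>x \<in> carrier H; y \<in> carrier H\<rbrakk> \<Longrightarrow> T (x \<oplus> y) = T x \<oplus> T y"
    and bounded_ops_scale: "x \<in> carrier H \<Longrightarrow> T (c \<odot>\<^bsub>H\<^esub> x) = c \<odot>\<^bsub>H\<^esub> T x"
  using assms by (auto simp: bounded_ops_def)

text \<open>On the zero space the constant in \<open>bounded_ops\<close> may be negative; the
  maximum with 0 makes it usable in monotonicity arguments.\<close>

lemma bounded_ops_bound:
  assumes "T \<in> bounded_ops H"
  obtains C where "C \<ge> 0" "\<And>x. x \<in> carrier H \<Longrightarrow> hnorm H (T x) \<le> C * hnorm H x"
proof -
  obtain C where C: "\<And>x. x \<in> carrier H \<Longrightarrow> hnorm H (T x) \<le> C * hnorm H x"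
    using assms unfolding bounded_ops_def by blast
  show ?thesis
  proof (rule that[of "max 0 C"])
    fix x assume x: "x \<in> carrier H"
    then have "C * hnorm H x \<le> max 0 C * hnorm H x"
      by (intro mult_right_mono) auto
    then show "hnorm H (T x) \<le> max 0 C * hnorm H x"
      using C[OF x] by simp
  qed simp
qed

section \<open>The operator norm\<close>

lemma hnorm_le_op_norm:
  assumes T: "T \<in> bounded_ops H" and x: "x \<in> carrier H"
  shows "hnorm H (T x) \<le> op_norm H T * hnorm H x"
proof (cases "hnorm H x = 0")
  case True
  obtain C where "hnorm H (T x) \<le> C * hnorm H x"
    using bounded_ops_bound[OF T] x by blast
  with True show ?thesis
    by simp
next
  case False
  define c where "c = hnorm H x"
  have c: "c > 0"
    using False hnorm_nonneg[OF x] by (simp add: c_def less_le)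
  define u where "u = of_real (1 / c) \<odot>\<^bsub>H\<^esub> x"
  have u: "u \<in> carrier H" "hnorm H u \<le> 1"
    using x c by (simp_all add: u_def hnorm_smult norm_divide c_def)
  obtain C where C: "C \<ge> 0" "\<And>x. x \<in> carrier H \<Longrightarrow> hnorm H (T x) \<le> C * hnorm H x"
    using bounded_ops_bound[OF T] by blast
  have "hnorm H (T y) \<le> C" if "y \<in> carrier H" "hnorm H y \<le> 1" for y
    using C(2)[OF that(1)] mult_left_mono[OF that(2) C(1)] by simp
  \<comment> \<open>A real supremum dominates the members of its set only once the set is known to
    be bounded above.\<close>
  then have "bdd_above {hnorm H (T x) |x. x \<in> carrier H \<and> hnorm H x \<le> 1}"
    by (intro bdd_aboveI[of _ C]) auto
  then have "hnorm H (T u) \<le> op_norm H T"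
    unfolding op_norm_def using u by (intro cSup_upper) auto
  moreover have "hnorm H (T u) = hnorm H (T x) / c"
    using x c T by (simp add: u_def bounded_ops_scale bounded_ops_closed hnorm_smult norm_divide)
  ultimately show ?thesis
    using c by (simp add: field_simps flip: c_def)
qed

lemma op_norm_le:
  assumes "\<And>x. \<lbrakk>x \<in> carrier H; hnorm H x \<le> 1\<rbrakk> \<Longrightarrow> hnorm H (T x) \<le> C"
  shows "op_norm H T \<le> C"
  unfolding op_norm_def
proof (rule cSup_least)
  show "{hnorm H (T x) |x. x \<in> carrier H \<and> hnorm H x \<le> 1} \<noteq> {}"
    using M.zero_closed by force
qed (use assms in auto)

lemma op_norm_nonneg:
  assumes T: "T \<in> bounded_ops H"
  shows "0 \<le> op_norm H T"
proof (cases "\<exists>x\<in>carrier H. hnorm H x \<noteq> 0")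
  case True
  then obtain x where x: "x \<in> carrier H" "hnorm H x > 0"
    using hnorm_nonneg less_eq_real_def by metis
  then have "0 \<le> op_norm H T * hnorm H x"
    using hnorm_le_op_norm[OF T x(1)] hnorm_nonneg[OF bounded_ops_closed[OF T x(1)]] by linarith
  then show ?thesis
    using x by (simp add: zero_le_mult_iff)
next
  case False
  then have "hnorm H (T x) = 0" if "x \<in> carrier H" for x
    using bounded_ops_closed[OF T that] by blast
  then have "{hnorm H (T x) |x. x \<in> carrier H \<and> hnorm H x \<le> 1} = {0}"
    using M.zero_closed hnorm_zero by force
  then show ?thesis
    by (simp add: op_norm_def)
qed

section \<open>Closure of the bounded operators under algebraic operations\<close>

lemma id_bounded_ops: "id \<in> bounded_ops H"
  by (rule bounded_opsI[where C = 1]) auto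

lemma comp_bounded_ops:
  assumes S: "S \<in> bounded_ops H" and T: "T \<in> bounded_ops H"
  shows "S \<circ> T \<in> bounded_ops H"
proof -
  obtain C where C: "C \<ge> 0" "\<And>x. x \<in> carrier H \<Longrightarrow> hnorm H (S x) \<le> C * hnorm H x"
    using bounded_ops_bound[OF S] by blast
  obtain D where D: "D \<ge> 0" "\<And>x. x \<in> carrier H \<Longrightarrow> hnorm H (T x) \<le> D * hnorm H x"
    using bounded_ops_bound[OF T] by blast
  show ?thesis
  proof (rule bounded_opsI[where C = "C * D"])
    fix x assume x: "x \<in> carrier H"
    have "hnorm H (S (T x)) \<le> C * (D * hnorm H x)"
      using C(2)[OF bounded_ops_closed[OF T x]] mult_left_mono[OF D(2)[OF x] C(1)] by linarith
    then show "hnorm H ((S \<circ> T) x) \<le> C * D * hnorm H x"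
      by (simp add: mult.assoc)
  qed (use S T in \<open>simp_all add: bounded_ops_closed bounded_ops_add bounded_ops_scale\<close>)
qed

lemma op_add_bounded_ops:
  assumes S: "S \<in> bounded_ops H" and T: "T \<in> bounded_ops H"
  shows "op_add H S T \<in> bounded_ops H"
proof -
  obtain C where C: "\<And>x. x \<in> carrier H \<Longrightarrow> hnorm H (S x) \<le> C * hnorm H x"
    using bounded_ops_bound[OF S] by blast
  obtain D where D: "\<And>x. x \<in> carrier H \<Longrightarrow> hnorm H (T x) \<le> D * hnorm H x"
    using bounded_ops_bound[OF T] by blast
  note ST = bounded_ops_closed[OF S] bounded_ops_closed[OF T]
  show ?thesis
  proof (rule bounded_opsI[where C = "C + D"])
    fix x assume x: "x \<in> carrier H"
    have "hnorm H (S x \<oplus> T x) \<le> hnorm H (S x) + hnorm H (T x)"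
      using x by (intro hnorm_add_le ST)
    then show "hnorm H (op_add H S T x) \<le> (C + D) * hnorm H x"
      using C[OF x] D[OF x] by (simp add: op_add_def algebra_simps)
  next
    fix x y assume "x \<in> carrier H" "y \<in> carrier H"
    then show "op_add H S T (x \<oplus> y) = op_add H S T x \<oplus> op_add H S T y"
      by (intro cinner_ext)
        (simp_all add: op_add_def bounded_ops_add[OF S] bounded_ops_add[OF T] ST cinner_simps
          algebra_simps)
  next
    fix c x assume "x \<in> carrier H"
    then show "op_add H S T (c \<odot>\<^bsub>H\<^esub> x) = c \<odot>\<^bsub>H\<^esub> op_add H S T x"
      by (intro cinner_ext)
        (simp_all add: op_add_def bounded_ops_scale[OF S] bounded_ops_scale[OF T] ST cinner_simps
          algebra_simps)
  qed (simp_all add: op_add_def ST)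
qed

lemma op_scale_bounded_ops:
  assumes T: "T \<in> bounded_ops H"
  shows "op_scale H c T \<in> bounded_ops H"
proof -
  obtain C where C: "\<And>x. x \<in> carrier H \<Longrightarrow> hnorm H (T x) \<le> C * hnorm H x"
    using bounded_ops_bound[OF T] by blast
  note cl = bounded_ops_closed[OF T]
  show ?thesis
  proof (rule bounded_opsI[where C = "cmod c * C"])
    fix x assume x: "x \<in> carrier H"
    show "hnorm H (op_scale H c T x) \<le> cmod c * C * hnorm H x"
      using mult_left_mono[OF C[OF x], of "cmod c"] x
      by (simp add: op_scale_def hnorm_smult cl mult.assoc)
  next
    fix x y assume "x \<in> carrier H" "y \<in> carrier H"
    then show "op_scale H c T (x \<oplus> y) = op_scale H c T x \<oplus> op_scale H c T y"
      by (intro cinner_ext)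
        (simp_all add: op_scale_def bounded_ops_add[OF T] cl cinner_simps algebra_simps)
  next
    fix d x assume "x \<in> carrier H"
    then show "op_scale H c T (d \<odot>\<^bsub>H\<^esub> x) = d \<odot>\<^bsub>H\<^esub> op_scale H c T x"
      by (intro cinner_ext)
        (simp_all add: op_scale_def bounded_ops_scale[OF T] cl cinner_simps algebra_simps)
  qed (simp_all add: op_scale_def cl)
qed

text \<open>Operators matter only on the carrier. Differences and finite sums agree there with
  combinations already known to be bounded.\<close>

lemma bounded_ops_cong:
  assumes T: "T \<in> bounded_ops H" and eq: "\<And>x. x \<in> carrier H \<Longrightarrow> S x = T x"
  shows "S \<in> bounded_ops H"
proof -
  obtain C where C: "\<And>x. x \<in> carrier H \<Longrightarrow> hnorm H (T x) \<le> C * hnorm H x"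
    using bounded_ops_bound[OF T] by blast
  show ?thesis
    by (rule bounded_opsI[where C = C])
      (simp_all add: eq C bounded_ops_closed[OF T] bounded_ops_add[OF T] bounded_ops_scale[OF T])
qed

lemma op_diff_bounded_ops:
  assumes S: "S \<in> bounded_ops H" and T: "T \<in> bounded_ops H"
  shows "op_diff H S T \<in> bounded_ops H"
proof (rule bounded_ops_cong)
  show "op_add H S (op_scale H (-1) T) \<in> bounded_ops H"
    by (intro op_add_bounded_ops op_scale_bounded_ops S T)
  fix x assume "x \<in> carrier H"
  then show "op_diff H S T x = op_add H S (op_scale H (-1) T) x"
    by (intro cinner_ext)
      (simp_all add: op_diff_def op_add_def op_scale_def cinner_simps
        bounded_ops_closed[OF S] bounded_ops_closed[OF T])
qed

lemma op_sum_bounded_ops: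
  assumes "finite A" "\<And>i. i \<in> A \<Longrightarrow> F i \<in> bounded_ops H"
  shows "op_sum H F A \<in> bounded_ops H"
  using assms
proof (induction A)
  case empty
  show ?case
    by (rule bounded_opsI[where C = 0]) (simp_all add: op_sum_def smult_zero)
next
  case (insert i A)
  show ?case
  proof (rule bounded_ops_cong)
    show "op_add H (F i) (op_sum H F A) \<in> bounded_ops H"
      using insert by (intro op_add_bounded_ops) auto
    fix x assume "x \<in> carrier H"
    then show "op_sum H F (insert i A) x = op_add H (F i) (op_sum H F A) x"
      using insert bounded_ops_closed by (simp add: op_sum_def op_add_def Pi_def)
  qed
qed

lemma cinner_op_sum:
  assumes "finite A" "\<And>i. i \<in> A \<Longrightarrow> F i \<in> bounded_ops H" "x \<in> carrier H" "y \<in> carrier H"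
  shows "cinner H (op_sum H F A x) y = (\<Sum>i\<in>A. cinner H (F i x) y)"
  using assms bounded_ops_closed unfolding op_sum_def by (intro cinner_finsum_left) auto

subsection \<open>The adjoint of a bounded operator\<close>

text \<open>By \<open>cinner_ext\<close> at most one vector satisfies the defining identity, so the
  definite description is resolved by exhibiting one.\<close>

lemma adjoint_op_eqI:
  assumes "z \<in> carrier H" "\<And>x. x \<in> carrier H \<Longrightarrow> cinner H (T x) y = cinner H x z"
  shows "adjoint_op H T y = z"
  unfolding adjoint_op_def
proof (rule the_equality)
  fix w assume w: "w \<in> carrier H \<and> (\<forall>x\<in>carrier H. cinner H (T x) y = cinner H x w)"
  with assms show "w = z"
    by (intro cinner_ext) metis+
qed (use assms in blast)

lemma
  assumes T: "T \<in> bounded_ops H" and y: "y \<in> carrier H"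
  shows adjoint_op_closed: "adjoint_op H T y \<in> carrier H"
    and cinner_adjoint_op: "x \<in> carrier H \<Longrightarrow> cinner H (T x) y = cinner H x (adjoint_op H T y)"
proof -
  note cl = bounded_ops_closed[OF T]
  obtain C where C: "\<And>x. x \<in> carrier H \<Longrightarrow> hnorm H (T x) \<le> C * hnorm H x"
    using bounded_ops_bound[OF T] by blast
  \<comment> \<open>The Riesz vector of the functional sending \<open>x\<close> to
    \<open>cinner H (T x) y\<close> is the one that \<open>adjoint_op\<close> describes.\<close>
  have "\<exists>z\<in>carrier H. \<forall>x\<in>carrier H. cinner H (T x) y = cinner H x z"
  proof (rule riesz[where C = "C * hnorm H y"])
    fix x assume x: "x \<in> carrier H"
    have "cmod (cinner H (T x) y) \<le> hnorm H (T x) * hnorm H y"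
      using x y cl by (intro cauchy_schwarz)
    also have "\<dots> \<le> C * hnorm H x * hnorm H y"
      using C[OF x] y by (intro mult_right_mono) auto
    finally show "cmod (cinner H (T x) y) \<le> C * hnorm H y * hnorm H x"
      by (simp add: mult_ac)
  qed (use y in \<open>simp_all add: bounded_ops_add[OF T] bounded_ops_scale[OF T] cl cinner_simps\<close>)
  then obtain z where z: "z \<in> carrier H" "\<And>x. x \<in> carrier H \<Longrightarrow> cinner H (T x) y = cinner H x z"
    by blast
  then have "adjoint_op H T y = z"
    by (rule adjoint_op_eqI)
  with z show "adjoint_op H T y \<in> carrier H"
    and "x \<in> carrier H \<Longrightarrow> cinner H (T x) y = cinner H x (adjoint_op H T y)"
    by simp_all
qed

lemma adjoint_op_bounded_ops:
  assumes T: "T \<in> bounded_ops H"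
  shows "adjoint_op H T \<in> bounded_ops H"
proof -
  note cl = adjoint_op_closed[OF T] bounded_ops_closed[OF T]
  note adj = cinner_adjoint_op[OF T]
  obtain C where C: "C \<ge> 0" "\<And>x. x \<in> carrier H \<Longrightarrow> hnorm H (T x) \<le> C * hnorm H x"
    using bounded_ops_bound[OF T] by blast
  show ?thesis
  proof (rule bounded_opsI[where C = C])
    fix y assume y: "y \<in> carrier H"
    define v where "v = adjoint_op H T y"
    have v: "v \<in> carrier H"
      using y cl by (simp add: v_def)
    \<comment> \<open>Test the adjoint identity at \<open>v\<close> itself; one factor
      \<open>hnorm H v\<close> cancels at the end, the case of norm 0 being immediate.\<close>
    have "(hnorm H v)\<^sup>2 = Re (cinner H (T v) y)"
      using y v by (simp add: hnorm_sq adj v_def)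
    also have "\<dots> \<le> hnorm H (T v) * hnorm H y"
      by (rule Re_cinner_le[OF cl(2)[OF v] y])
    also have "\<dots> \<le> C * hnorm H v * hnorm H y"
      using C(2)[OF v] y by (intro mult_right_mono) auto
    finally have "hnorm H v * hnorm H v \<le> hnorm H v * (C * hnorm H y)"
      by (simp add: power2_eq_square mult_ac)
    moreover have "0 \<le> C * hnorm H y"
      using C(1) y by simp
    ultimately have "hnorm H v \<le> C * hnorm H y"
      using hnorm_nonneg[OF v] by (cases "hnorm H v = 0") (auto simp: mult_le_cancel_left)
    then show "hnorm H (adjoint_op H T y) \<le> C * hnorm H y"
      by (simp add: v_def)
  next
    fix x y assume "x \<in> carrier H" "y \<in> carrier H"
    then show "adjoint_op H T (x \<oplus> y) = adjoint_op H T x \<oplus> adjoint_op H T y"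
      by (intro adjoint_op_eqI) (simp_all add: cl adj cinner_simps)
  next
    fix c x assume "x \<in> carrier H"
    then show "adjoint_op H T (c \<odot>\<^bsub>H\<^esub> x) = c \<odot>\<^bsub>H\<^esub> adjoint_op H T x"
      by (intro adjoint_op_eqI) (simp_all add: cl adj cinner_simps)
  qed (rule cl)
qed

lemma cinner_Re_op:
  assumes T: "T \<in> bounded_ops H" and x: "x \<in> carrier H"
  shows "cinner H (Re_op H T x) x = of_real (Re (cinner H (T x) x))"
proof -
  have "cinner H (adjoint_op H T x) x = cnj (cinner H (T x) x)"
    using cinner_adjoint_op[OF T x x] cinner_commute[OF adjoint_op_closed[OF T x] x] by simp
  then have "cinner H (Re_op H T x) x = (1/2) * (cinner H (T x) x + cnj (cinner H (T x) x))"
    using x by (simp add: Re_op_def op_scale_def op_add_def cinner_simps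
        adjoint_op_closed[OF T] bounded_ops_closed[OF T])
  then show ?thesis
    by (simp add: complex_add_cnj)
qed

text \<open>The quadratic form of \<open>Re_op H T\<close> is the real part of that of
  \<open>T\<close>. This turns the hypothesis on the real part of \<open>f\<close> into a scalar
  inequality at a chosen vector.\<close>

lemma op_le_Re_op_id:
  assumes T: "T \<in> bounded_ops H" and x: "x \<in> carrier H" and le: "op_le H (Re_op H T) id"
  shows "Re (cinner H (T x) x) \<le> Re (cinner H x x)"
proof -
  have "Re_op H T x \<in> carrier H"
    using x by (simp add: Re_op_def op_scale_def op_add_def
        adjoint_op_closed[OF T] bounded_ops_closed[OF T])
  then have "cinner H (op_diff H id (Re_op H T) x) x
      = cinner H x x - of_real (Re (cinner H (T x) x))"
    using x by (simp add: op_diff_def cinner_simps cinner_Re_op[OF T])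
  moreover have "0 \<le> Re (cinner H (op_diff H id (Re_op H T) x) x)"
    using le x unfolding op_le_def by blast
  ultimately show ?thesis
    by simp
qed

subsection \<open>Row operators\<close>

lemma word_op_bounded_ops:
  "(\<And>i. T i \<in> bounded_ops H) \<Longrightarrow> word_op T \<alpha> \<in> bounded_ops H"
  by (induction \<alpha>) (auto simp: word_op_def id_bounded_ops intro: comp_bounded_ops)

lemma homogeneous_part_bounded_ops:
  "(\<And>i. T i \<in> bounded_ops H) \<Longrightarrow> homogeneous_part H a T k \<in> bounded_ops H"
  unfolding homogeneous_part_def
  by (intro op_sum_bounded_ops op_scale_bounded_ops word_op_bounded_ops) auto

lemma cinner_homogeneous_part:
  assumes "\<And>i. T i \<in> bounded_ops H" "x \<in> carrier H" "y \<in> carrier H"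
  shows "cinner H (homogeneous_part H a T k x) y
    = (\<Sum>\<alpha> | length \<alpha> = k. a \<alpha> * cinner H (word_op T \<alpha> x) y)"
proof -
  note W = word_op_bounded_ops[of T, OF assms(1)]
  have "cinner H (homogeneous_part H a T k x) y
      = (\<Sum>\<alpha> | length \<alpha> = k. cinner H (op_scale H (a \<alpha>) (word_op T \<alpha>) x) y)"
    unfolding homogeneous_part_def
    by (intro cinner_op_sum op_scale_bounded_ops W assms) auto
  then show ?thesis
    using assms bounded_ops_closed[OF W] by (simp add: op_scale_def cinner_smult_left)
qed

lemma row_square_bounded_ops:
  fixes T :: "'n::finite \<Rightarrow> 'a \<Rightarrow> 'a"
  assumes "\<And>i. T i \<in> bounded_ops H"
  shows "row_square H T \<in> bounded_ops H"
  unfolding row_square_def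
  by (intro op_sum_bounded_ops comp_bounded_ops adjoint_op_bounded_ops assms) auto

text \<open>The left-hand side is the quadratic form of \<open>row_square H T\<close> at
  \<open>y\<close>: a bound on the row is a bound on the column of adjoints.\<close>

lemma sum_adjoint_op_le:
  fixes T :: "'n::finite \<Rightarrow> 'a \<Rightarrow> 'a"
  assumes T: "\<And>i. T i \<in> bounded_ops H" and y: "y \<in> carrier H"
  shows "(\<Sum>i\<in>UNIV. (hnorm H (adjoint_op H (T i) y))\<^sup>2) \<le> op_norm H (row_square H T) * (hnorm H y)\<^sup>2"
proof -
  note R = row_square_bounded_ops[of T, OF T]
  have "cinner H (row_square H T y) y = (\<Sum>i\<in>UNIV. cinner H ((T i \<circ> adjoint_op H (T i)) y) y)"
    unfolding row_square_def
    by (intro cinner_op_sum comp_bounded_ops adjoint_op_bounded_ops T y) auto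
  then have "(\<Sum>i\<in>UNIV. (hnorm H (adjoint_op H (T i) y))\<^sup>2) = Re (cinner H (row_square H T y) y)"
    using y by (simp add: cinner_adjoint_op[OF T] adjoint_op_closed[OF T] hnorm_sq)
  also have "\<dots> \<le> hnorm H (row_square H T y) * hnorm H y"
    by (rule Re_cinner_le[OF bounded_ops_closed[OF R y] y])
  also have "\<dots> \<le> op_norm H (row_square H T) * hnorm H y * hnorm H y"
    using hnorm_le_op_norm[OF R y] y by (intro mult_right_mono) auto
  finally show ?thesis
    by (simp add: power2_eq_square mult_ac)
qed

text \<open>Converse of \<open>sum_adjoint_op_le\<close>. Pairing the image \<open>v\<close> of
  \<open>x\<close> with itself gives a sum of inner products of adjoint images of \<open>x\<close>
  and \<open>v\<close>; Cauchy-Schwarz in each component and then over the components leaves one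
  factor \<open>hnorm H v\<close> to cancel.\<close>

lemma op_norm_row_square_le:
  fixes T :: "'n::finite \<Rightarrow> 'a \<Rightarrow> 'a"
  assumes T: "\<And>i. T i \<in> bounded_ops H"
    and le: "\<And>y. y \<in> carrier H \<Longrightarrow> (\<Sum>i\<in>UNIV. (hnorm H (adjoint_op H (T i) y))\<^sup>2) \<le> q * (hnorm H y)\<^sup>2"
    and q: "0 \<le> q"
  shows "op_norm H (row_square H T) \<le> q"
proof (rule op_norm_le)
  fix x assume x: "x \<in> carrier H" "hnorm H x \<le> 1"
  define v where "v = row_square H T x"
  have v: "v \<in> carrier H"
    unfolding v_def by (rule bounded_ops_closed[OF row_square_bounded_ops[of T, OF T] x(1)])
  note cl = adjoint_op_closed[OF T x(1)]
  have sqrt_le: "sqrt (\<Sum>i\<in>UNIV. (hnorm H (adjoint_op H (T i) y))\<^sup>2) \<le> sqrt q * hnorm H y"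
    if "y \<in> carrier H" for y
    using real_sqrt_le_mono[OF le[OF that]] that by (simp add: real_sqrt_mult)
  have "cinner H (row_square H T x) v = (\<Sum>i\<in>UNIV. cinner H ((T i \<circ> adjoint_op H (T i)) x) v)"
    unfolding row_square_def
    by (intro cinner_op_sum comp_bounded_ops adjoint_op_bounded_ops T x v) auto
  also have "\<dots> = (\<Sum>i\<in>UNIV. cinner H (adjoint_op H (T i) x) (adjoint_op H (T i) v))"
    by (simp add: cinner_adjoint_op[OF T v] cl)
  finally have "(hnorm H v)\<^sup>2
      = (\<Sum>i\<in>UNIV. Re (cinner H (adjoint_op H (T i) x) (adjoint_op H (T i) v)))"
    using v by (simp add: hnorm_sq v_def)
  also have "\<dots> \<le> (\<Sum>i\<in>UNIV. hnorm H (adjoint_op H (T i) x) * hnorm H (adjoint_op H (T i) v))"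
    by (intro sum_mono Re_cinner_le cl adjoint_op_closed[OF T v])
  also have "\<dots> \<le> sqrt (\<Sum>i\<in>UNIV. (hnorm H (adjoint_op H (T i) x))\<^sup>2)
      * sqrt (\<Sum>i\<in>UNIV. (hnorm H (adjoint_op H (T i) v))\<^sup>2)"
    by (rule sum_mult_le_sqrt)
  also have "\<dots> \<le> (sqrt q * hnorm H x) * (sqrt q * hnorm H v)"
    using x q by (intro mult_mono sqrt_le x v) (auto simp: sum_nonneg)
  also have "\<dots> = hnorm H v * (q * hnorm H x)"
    using q by simp
  finally have "hnorm H v * hnorm H v \<le> hnorm H v * (q * hnorm H x)"
    by (simp add: power2_eq_square)
  moreover have "0 \<le> q * hnorm H x"
    using q x by simp
  ultimately have "hnorm H v \<le> q * hnorm H x"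
    using hnorm_nonneg[OF v] by (cases "hnorm H v = 0") (auto simp: mult_le_cancel_left)
  also have "\<dots> \<le> q"
    using q x by (simp add: mult_left_le)
  finally show "hnorm H (row_square H T x) \<le> q"
    by (simp add: v_def)
qed

lemma fold_adjoint_op_closed:
  "\<lbrakk>\<And>i. T i \<in> bounded_ops H; y \<in> carrier H\<rbrakk> \<Longrightarrow> fold (\<lambda>i. adjoint_op H (T i)) \<alpha> y \<in> carrier H"
  by (induction \<alpha> arbitrary: y) (auto simp: adjoint_op_closed)

text \<open>The first letter of a word acts last, so its adjoint acts first, which is the order of
  \<open>fold\<close>.\<close>

lemma cinner_word_op:
  assumes T: "\<And>i. T i \<in> bounded_ops H" and "x \<in> carrier H" "y \<in> carrier H"
  shows "cinner H (word_op T \<alpha> x) y = cinner H x (fold (\<lambda>i. adjoint_op H (T i)) \<alpha> y)"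
  using assms(3)
proof (induction \<alpha> arbitrary: y)
  case (Cons i \<alpha>)
  have "cinner H (word_op T (i # \<alpha>) x) y = cinner H (T i (word_op T \<alpha> x)) y"
    by (simp add: word_op_def)
  also have "\<dots> = cinner H (word_op T \<alpha> x) (adjoint_op H (T i) y)"
    by (rule cinner_adjoint_op[OF T Cons.prems bounded_ops_closed[OF word_op_bounded_ops[of T, OF T] assms(2)]])
  also have "\<dots> = cinner H x (fold (\<lambda>i. adjoint_op H (T i)) \<alpha> (adjoint_op H (T i) y))"
    by (rule Cons.IH[OF adjoint_op_closed[OF T Cons.prems]])
  finally show ?case
    by simp
qed (simp add: word_op_def)

text \<open>This is the bound on the row of all words of length \<open>k\<close>, in column form.
  After the first letter is removed, the induction hypothesis applies at each
  \<open>adjoint_op H (T i) y\<close>, hence the generalisation over \<open>y\<close>, and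
  \<open>sum_adjoint_op_le\<close> supplies the remaining factor.\<close>

lemma sum_fold_adjoint_op_le:
  fixes T :: "'n::finite \<Rightarrow> 'a \<Rightarrow> 'a"
  assumes T: "\<And>i. T i \<in> bounded_ops H" and "y \<in> carrier H"
  shows "(\<Sum>\<alpha> | length \<alpha> = k. (hnorm H (fold (\<lambda>i. adjoint_op H (T i)) \<alpha> y))\<^sup>2)
    \<le> op_norm H (row_square H T) ^ k * (hnorm H y)\<^sup>2"
  using assms(2)
proof (induction k arbitrary: y)
  case (Suc k)
  define q where "q = op_norm H (row_square H T)"
  have q: "q \<ge> 0"
    unfolding q_def by (intro op_norm_nonneg row_square_bounded_ops T)
  have "(\<Sum>\<alpha> | length \<alpha> = Suc k. (hnorm H (fold (\<lambda>i. adjoint_op H (T i)) \<alpha> y))\<^sup>2)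
      \<le> (\<Sum>i\<in>UNIV. q ^ k * (hnorm H (adjoint_op H (T i) y))\<^sup>2)"
    using Suc.IH[OF adjoint_op_closed[OF T Suc.prems]]
    by (simp add: sum_words_Suc q_def sum_mono)
  also have "\<dots> \<le> q ^ k * (q * (hnorm H y)\<^sup>2)"
    unfolding sum_distrib_left[symmetric] q_def
    using q by (intro mult_left_mono sum_adjoint_op_le T Suc.prems) (simp add: q_def)
  finally show ?case
    by (simp add: q_def mult_ac)
qed simp

lemma op_norm_homogeneous_part_le:
  fixes T :: "'n::finite \<Rightarrow> 'a \<Rightarrow> 'a"
  assumes T: "\<And>i. T i \<in> bounded_ops H"
  shows "op_norm H (homogeneous_part H c T k)
    \<le> sqrt (\<Sum>\<alpha> | length \<alpha> = k. (cmod (c \<alpha>))\<^sup>2) * sqrt (op_norm H (row_square H T)) ^ k"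
proof (rule op_norm_le)
  fix x assume x: "x \<in> carrier H" "hnorm H x \<le> 1"
  define q where "q = op_norm H (row_square H T)"
  have q: "q \<ge> 0"
    unfolding q_def by (intro op_norm_nonneg row_square_bounded_ops T)
  define v where "v = homogeneous_part H c T k x"
  define w where "w \<alpha> = fold (\<lambda>i. adjoint_op H (T i)) \<alpha> v" for \<alpha>
  define A where "A = sqrt (\<Sum>\<alpha> | length \<alpha> = k. (cmod (c \<alpha>))\<^sup>2)"
  have v: "v \<in> carrier H"
    unfolding v_def by (rule bounded_ops_closed[OF homogeneous_part_bounded_ops[of T, OF T] x(1)])
  have w: "w \<alpha> \<in> carrier H" for \<alpha>
    unfolding w_def by (intro fold_adjoint_op_closed T v)
  \<comment> \<open>Pair \<open>v\<close> with itself and move the words onto the second argument.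
    Cauchy-Schwarz over the words then separates the coefficients from the adjoint words, and a
    factor \<open>hnorm H v\<close> cancels.\<close>
  have "(hnorm H v)\<^sup>2 = Re (cinner H (homogeneous_part H c T k x) v)"
    using v by (simp add: hnorm_sq v_def)
  also have "\<dots> = Re (\<Sum>\<alpha> | length \<alpha> = k. c \<alpha> * cinner H x (w \<alpha>))"
    by (simp add: cinner_homogeneous_part[of T, OF T x(1) v] cinner_word_op[of T, OF T x(1) v] w_def)
  also have "\<dots> \<le> (\<Sum>\<alpha> | length \<alpha> = k. cmod (c \<alpha> * cinner H x (w \<alpha>)))"
    by (rule order_trans[OF complex_Re_le_cmod norm_sum])
  also have "\<dots> \<le> (\<Sum>\<alpha> | length \<alpha> = k. cmod (c \<alpha>) * hnorm H (w \<alpha>))"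
  proof (rule sum_mono)
    fix \<alpha> :: "'n list"
    have "cmod (cinner H x (w \<alpha>)) \<le> hnorm H x * hnorm H (w \<alpha>)"
      by (intro cauchy_schwarz x w)
    also have "\<dots> \<le> hnorm H (w \<alpha>)"
      using x w[of \<alpha>] by (simp add: mult_left_le_one_le)
    finally show "cmod (c \<alpha> * cinner H x (w \<alpha>)) \<le> cmod (c \<alpha>) * hnorm H (w \<alpha>)"
      by (simp add: norm_mult mult_left_mono)
  qed
  also have "\<dots> \<le> A * sqrt (\<Sum>\<alpha> | length \<alpha> = k. (hnorm H (w \<alpha>))\<^sup>2)"
    unfolding A_def by (rule sum_mult_le_sqrt)
  also have "\<dots> \<le> A * sqrt (q ^ k * (hnorm H v)\<^sup>2)"
    unfolding w_def q_def
    by (intro mult_left_mono real_sqrt_le_mono sum_fold_adjoint_op_le T v) (simp add: A_def sum_nonneg)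
  also have "\<dots> = A * sqrt q ^ k * hnorm H v"
    using v by (simp add: real_sqrt_mult real_sqrt_power)
  finally have "hnorm H v * hnorm H v \<le> hnorm H v * (A * sqrt q ^ k)"
    by (simp add: power2_eq_square mult_ac)
  moreover have "0 \<le> A * sqrt q ^ k"
    using q by (simp add: A_def sum_nonneg)
  ultimately show "hnorm H v \<le> A * sqrt q ^ k"
    using hnorm_nonneg[OF v] by (cases "hnorm H v = 0") (auto simp: mult_le_cancel_left)
qed

subsection \<open>Free series\<close>

text \<open>Norm convergence implies weak convergence, which replaces the operator series by a
  scalar series at fixed vectors.\<close>

lemma free_series_sums_tendsto:
  fixes Z :: "'n::finite \<Rightarrow> 'a \<Rightarrow> 'a"
  assumes Z: "\<And>i. Z i \<in> bounded_ops H" and L: "free_series_sums H a Z L"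
    and x: "x \<in> carrier H" and y: "y \<in> carrier H"
  shows "(\<lambda>k. \<Sum>\<alpha> | length \<alpha> = k. a \<alpha> * cinner H (word_op Z \<alpha> x) y) sums cinner H (L x) y"
  unfolding sums_def
proof (rule LIM_zero_cancel)
  have LB: "L \<in> bounded_ops H"
    using L by (simp add: free_series_sums_def)
  define D where "D N = op_diff H (op_sum H (homogeneous_part H a Z) {..<N}) L" for N
  have P: "op_sum H (homogeneous_part H a Z) {..<N} \<in> bounded_ops H" for N
    by (intro op_sum_bounded_ops homogeneous_part_bounded_ops Z) auto
  have DB: "D N \<in> bounded_ops H" for N
    unfolding D_def by (intro op_diff_bounded_ops P LB)
  have eq: "cinner H (D N x) y
      = (\<Sum>k<N. \<Sum>\<alpha> | length \<alpha> = k. a \<alpha> * cinner H (word_op Z \<alpha> x) y) - cinner H (L x) y" for N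
    using x y homogeneous_part_bounded_ops[of Z, OF Z]
    by (simp add: D_def op_diff_def cinner_diff_left bounded_ops_closed[OF P] bounded_ops_closed[OF LB]
        cinner_op_sum cinner_homogeneous_part[of Z, OF Z])
  have "(\<lambda>N. op_norm H (D N) * hnorm H x * hnorm H y) \<longlonglongrightarrow> 0 * hnorm H x * hnorm H y"
    using L unfolding free_series_sums_def D_def by (intro tendsto_intros) auto
  then have lim: "(\<lambda>N. op_norm H (D N) * hnorm H x * hnorm H y) \<longlonglongrightarrow> 0"
    by simp
  have "cmod (cinner H (D N x) y) \<le> op_norm H (D N) * hnorm H x * hnorm H y" for N
  proof -
    have "cmod (cinner H (D N x) y) \<le> hnorm H (D N x) * hnorm H y"
      by (rule cauchy_schwarz[OF bounded_ops_closed[OF DB x] y])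
    also have "\<dots> \<le> op_norm H (D N) * hnorm H x * hnorm H y"
      using y by (intro mult_right_mono hnorm_le_op_norm[OF DB x]) auto
    finally show ?thesis .
  qed
  then have "(\<lambda>N. cinner H (D N x) y) \<longlonglongrightarrow> 0"
    by (intro Lim_null_comparison[OF _ lim] always_eventually) auto
  then show "(\<lambda>N. (\<Sum>k<N. \<Sum>\<alpha> | length \<alpha> = k. a \<alpha> * cinner H (word_op Z \<alpha> x) y)
      - cinner H (L x) y) \<longlonglongrightarrow> 0"
    unfolding eq .
qed

end

section \<open>A finite-dimensional truncation of the full Fock space\<close>

text \<open>Coordinate space over \<open>I\<close>, realised by functions that vanish off
  \<open>I\<close> so that its carrier lies in the type \<open>universe\<close> over which the
  hypotheses range.\<close>

definition fin_hilbert :: "nat set \<Rightarrow> universe hilbert" where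
  "fin_hilbert I = \<lparr>carrier = {x. \<forall>j. j \<notin> I \<longrightarrow> x j = 0},
     monoid.mult = undefined, one = undefined,
     ring.zero = (\<lambda>_. 0), add = (\<lambda>x y j. x j + y j), smult = (\<lambda>c x j. c * x j),
     cinner = (\<lambda>x y. \<Sum>j\<in>I. x j * cnj (y j))\<rparr>"

lemma fin_hilbert_simps [simp]:
  "x \<in> carrier (fin_hilbert I) \<longleftrightarrow> (\<forall>j. j \<notin> I \<longrightarrow> x j = 0)"
  "\<zero>\<^bsub>fin_hilbert I\<^esub> = (\<lambda>_. 0)"
  "x \<oplus>\<^bsub>fin_hilbert I\<^esub> y = (\<lambda>j. x j + y j)"
  "c \<odot>\<^bsub>fin_hilbert I\<^esub> x = (\<lambda>j. c * x j)"
  "cinner (fin_hilbert I) x y = (\<Sum>j\<in>I. x j * cnj (y j))"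
  by (simp_all add: fin_hilbert_def)

lemma abelian_group_fin_hilbert: "abelian_group (fin_hilbert I)"
proof (rule abelian_groupI)
  fix x assume "x \<in> carrier (fin_hilbert I)"
  then show "\<exists>y\<in>carrier (fin_hilbert I). y \<oplus>\<^bsub>fin_hilbert I\<^esub> x = \<zero>\<^bsub>fin_hilbert I\<^esub>"
    by (intro bexI[of _ "\<lambda>j. - x j"]) auto
qed (auto simp: algebra_simps)

lemma fin_hilbert_minus:
  assumes "x \<in> carrier (fin_hilbert I)" "y \<in> carrier (fin_hilbert I)"
  shows "x \<ominus>\<^bsub>fin_hilbert I\<^esub> y = (\<lambda>j. x j - y j)"
proof -
  interpret abelian_group "fin_hilbert I"
    by (rule abelian_group_fin_hilbert)
  have "\<ominus>\<^bsub>fin_hilbert I\<^esub> y = (\<lambda>j. - y j)"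
    using assms by (intro minus_equality) auto
  then show ?thesis
    by (simp add: minus_eq)
qed

lemma cinner_fin_hilbert_self:
  "cinner (fin_hilbert I) x x = of_real (\<Sum>j\<in>I. (cmod (x j))\<^sup>2)"
  by (simp add: complex_norm_square del: of_real_power)

lemma hnorm_fin_hilbert: "hnorm (fin_hilbert I) x = sqrt (\<Sum>j\<in>I. (cmod (x j))\<^sup>2)"
  unfolding hnorm_def cinner_fin_hilbert_self by simp

lemma hnorm_fin_hilbert_sq: "(hnorm (fin_hilbert I) x)\<^sup>2 = (\<Sum>j\<in>I. (cmod (x j))\<^sup>2)"
  by (simp add: hnorm_fin_hilbert sum_nonneg)

lemma hilbert_space_fin_hilbert:
  assumes I: "finite I"
  shows "hilbert_space (fin_hilbert I)"
proof -
  let ?H = "fin_hilbert I"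
  have module: "module (ring_of_type_algebra :: complex ring) ?H"
    by (rule moduleI[OF cring_from_type_algebra abelian_group_fin_hilbert])
      (auto simp: ring_of_type_algebra_def algebra_simps)
  note self = cinner_fin_hilbert_self
  show ?thesis
  proof (intro hilbert_space.intro module hilbert_space_axioms.intro)
    fix x assume x: "x \<in> carrier ?H" "cinner ?H x x = 0"
    then have "\<forall>j\<in>I. x j = 0"
      using I unfolding self by (simp add: sum_nonneg_eq_0_iff del: of_real_sum)
    then show "x = \<zero>\<^bsub>?H\<^esub>"
      using x(1) by auto
  next
    fix s :: "nat \<Rightarrow> universe"
    assume s: "\<And>m. s m \<in> carrier ?H"
      and cauchy: "\<forall>e>0. \<exists>N. \<forall>m\<ge>N. \<forall>k\<ge>N. hnorm ?H (s m \<ominus>\<^bsub>?H\<^esub> s k) < e"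
    \<comment> \<open>Each coordinate is dominated by the norm, so Cauchy sequences converge
      coordinatewise; as \<open>I\<close> is finite, this is convergence in norm.\<close>
    have le: "cmod (s m j - s k j) \<le> hnorm ?H (s m \<ominus>\<^bsub>?H\<^esub> s k)" if "j \<in> I" for m k j
    proof (rule power2_le_imp_le)
      have "(cmod (s m j - s k j))\<^sup>2 \<le> (\<Sum>j\<in>I. (cmod (s m j - s k j))\<^sup>2)"
        using I that by (intro member_le_sum) auto
      then show "(cmod (s m j - s k j))\<^sup>2 \<le> (hnorm ?H (s m \<ominus>\<^bsub>?H\<^esub> s k))\<^sup>2"
        by (simp only: hnorm_fin_hilbert_sq fin_hilbert_minus[OF s s])
      show "0 \<le> hnorm ?H (s m \<ominus>\<^bsub>?H\<^esub> s k)"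
        by (simp add: hnorm_fin_hilbert sum_nonneg)
    qed
    have "convergent (\<lambda>m. s m j)" if "j \<in> I" for j
    proof (rule Cauchy_convergent, rule metric_CauchyI)
      fix e :: real assume "e > 0"
      then obtain N where "\<forall>m\<ge>N. \<forall>k\<ge>N. hnorm ?H (s m \<ominus>\<^bsub>?H\<^esub> s k) < e"
        using cauchy by blast
      then show "\<exists>N. \<forall>m\<ge>N. \<forall>k\<ge>N. dist (s m j) (s k j) < e"
        by (auto simp: dist_norm intro!: exI[of _ N] le_less_trans[OF le[OF that]])
    qed
    then obtain l where l: "\<And>j. j \<in> I \<Longrightarrow> (\<lambda>m. s m j) \<longlonglongrightarrow> l j"
      unfolding convergent_def by metis
    \<comment> \<open>The values of \<open>l\<close> off \<open>I\<close> are unspecified; setting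
      them to 0 puts the limit into the carrier.\<close>
    define l' where "l' j = (if j \<in> I then l j else 0)" for j
    have l': "l' \<in> carrier ?H"
      by (simp add: l'_def)
    have "(\<lambda>m. sqrt (\<Sum>j\<in>I. (cmod (s m j - l' j))\<^sup>2)) \<longlonglongrightarrow> sqrt (\<Sum>j\<in>I. (cmod (l j - l' j))\<^sup>2)"
      by (intro tendsto_intros l) auto
    moreover have "hnorm ?H (s m \<ominus>\<^bsub>?H\<^esub> l') = sqrt (\<Sum>j\<in>I. (cmod (s m j - l' j))\<^sup>2)" for m
      unfolding fin_hilbert_minus[OF s l'] hnorm_fin_hilbert ..

    ultimately have "(\<lambda>m. hnorm ?H (s m \<ominus>\<^bsub>?H\<^esub> l')) \<longlonglongrightarrow> 0"
      by (simp add: l'_def)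
    with l' show "\<exists>l\<in>carrier ?H. (\<lambda>m. hnorm ?H (s m \<ominus>\<^bsub>?H\<^esub> l)) \<longlonglongrightarrow> 0"
      by blast
  next
    fix x show "0 \<le> Re (cinner ?H x x)"
      unfolding self by (simp add: sum_nonneg)
  qed (auto simp: sum.distrib sum_distrib_left algebra_simps intro!: sum.cong)
qed

text \<open>
  Vectors of the truncated Fock space are indexed by the codes of the words of length at most \<open>k\<close>;
  creating a letter on a word of length \<open>k\<close> gives \<open>0\<close>.
\<close>

definition fock_index :: "'n::finite itself \<Rightarrow> nat \<Rightarrow> nat set" where
  "fock_index _ k = to_nat ` {w :: 'n list. length w \<le> k}"

definition fock_vec :: "nat \<Rightarrow> ('n::finite list \<Rightarrow> complex) \<Rightarrow> universe" where
  "fock_vec k \<xi> = (\<lambda>j. if j \<in> fock_index TYPE('n) k then \<xi> (from_nat j) else 0)"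

definition creation :: "nat \<Rightarrow> real \<Rightarrow> 'n::finite \<Rightarrow> universe \<Rightarrow> universe" where
  "creation k r i x = fock_vec k (\<lambda>w. case w of [] \<Rightarrow> 0
     | j # w' \<Rightarrow> if j = i then of_real r * x (to_nat w') else 0)"

text \<open>The adjoint of \<open>creation\<close> in closed form: it strips a leading
  \<open>i\<close>. The guard reflects that \<open>i # w\<close> must still have length at most
  \<open>k\<close>.\<close>

definition annihilation :: "nat \<Rightarrow> real \<Rightarrow> 'n::finite \<Rightarrow> universe \<Rightarrow> universe" where
  "annihilation k r i x =
     fock_vec k (\<lambda>w. if length w < k then of_real r * x (to_nat (i # w)) else 0)"

abbreviation fock :: "'n::finite itself \<Rightarrow> nat \<Rightarrow> universe hilbert" where
  "fock t k \<equiv> fin_hilbert (fock_index t k)"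

lemma finite_words_le [simp]: "finite {w :: 'n::finite list. length w \<le> k}"
  using finite_lists_length_le[of "UNIV :: 'n set" k] by simp

lemma finite_words_less [simp]: "finite {w :: 'n::finite list. length w < k}"
  by (rule finite_subset[OF _ finite_words_le[of k]]) auto

lemma hilbert_space_fock: "hilbert_space (fock t k)"
  by (rule hilbert_space_fin_hilbert) (simp add: fock_index_def)

lemma sum_fock_index:
  "(\<Sum>j\<in>fock_index TYPE('n::finite) k. f j) = (\<Sum>w | length (w :: 'n list) \<le> k. f (to_nat w))"
  unfolding fock_index_def by (subst sum.reindex) (auto intro: inj_onI)

lemma fock_vec_closed: "fock_vec k (\<xi> :: 'n::finite list \<Rightarrow> complex) \<in> carrier (fock TYPE('n) k)"
  by (simp add: fock_vec_def)

lemma fock_vec_apply [simp]: "length (w :: 'n::finite list) \<le> k \<Longrightarrow> fock_vec k \<xi> (to_nat w) = \<xi> w"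
  by (auto simp: fock_vec_def fock_index_def)

text \<open>Only words that begin with \<open>i\<close> contribute, and deleting this letter leaves
  exactly the words of length below \<open>k\<close>. This reindexing expresses the shift made by a
  creation operator.\<close>

lemma sum_words_Cons:
  fixes g :: "'n::finite list \<Rightarrow> 'b::comm_monoid_add"
  shows "(\<Sum>w | length w \<le> k. case w of [] \<Rightarrow> 0 | j # w' \<Rightarrow> if j = i then g w' else 0)
    = (\<Sum>w | length w < k. g w)"
proof -
  let ?f = "\<lambda>w. case w of [] \<Rightarrow> 0 | j # w' \<Rightarrow> if j = i then g w' else 0"
  have "(\<Sum>w | length w \<le> k. ?f w) = (\<Sum>w\<in>Cons i ` {w. length w < k}. ?f w)"
    by (rule sum.mono_neutral_right) (auto split: list.splits)
  also have "\<dots> = (\<Sum>w | length w < k. g w)"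
    by (subst sum.reindex) auto
  finally show ?thesis .
qed

section \<open>Adjoints and norms of the creation operators\<close>

lemma cinner_creation:
  fixes i :: "'n::finite"
  shows "cinner (fock TYPE('n) k) (creation k r i x) y
    = cinner (fock TYPE('n) k) x (annihilation k r i y)"
proof -
  have "cinner (fock TYPE('n) k) (creation k r i x) y
      = (\<Sum>w | length (w :: 'n list) \<le> k. case w of [] \<Rightarrow> 0
          | j # w' \<Rightarrow> if j = i then of_real r * x (to_nat w') * cnj (y (to_nat (i # w'))) else 0)"
    unfolding fin_hilbert_simps sum_fock_index creation_def
    by (intro sum.cong) (auto split: list.splits)
  also have "\<dots> = (\<Sum>w | length (w :: 'n list) < k. of_real r * x (to_nat w) * cnj (y (to_nat (i # w))))"
    by (rule sum_words_Cons)
  also have "\<dots> = (\<Sum>w | length (w :: 'n list) \<le> k.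
      if length w < k then of_real r * x (to_nat w) * cnj (y (to_nat (i # w))) else 0)"
    by (rule sum.mono_neutral_cong_left) auto
  also have "\<dots> = cinner (fock TYPE('n) k) x (annihilation k r i y)"
    unfolding fin_hilbert_simps sum_fock_index annihilation_def
    by (intro sum.cong) auto
  finally show ?thesis .
qed

lemma annihilation_closed: "annihilation k r (i :: 'n::finite) x \<in> carrier (fock TYPE('n) k)"
  unfolding annihilation_def by (rule fock_vec_closed)

lemma creation_closed: "creation k r (i :: 'n::finite) x \<in> carrier (fock TYPE('n) k)"
  unfolding creation_def by (rule fock_vec_closed)

text \<open>Equality holds even at functions outside the carrier, since the inner product reads only
  the coordinates in \<open>fock_index\<close>.\<close>

lemma adjoint_op_creation:
  fixes i :: "'n::finite"
  shows "adjoint_op (fock TYPE('n) k) (creation k r i) = annihilation k r i"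
proof
  fix y
  interpret hilbert_space "fock TYPE('n) k"
    by (rule hilbert_space_fock)
  show "adjoint_op (fock TYPE('n) k) (creation k r i) y = annihilation k r i y"
    by (rule adjoint_op_eqI) (rule annihilation_closed cinner_creation)+
qed

lemma hnorm_creation_le:
  fixes i :: "'n::finite"
  shows "hnorm (fock TYPE('n) k) (creation k r i x) \<le> \<bar>r\<bar> * hnorm (fock TYPE('n) k) x"
proof (rule power2_le_imp_le)
  have "(hnorm (fock TYPE('n) k) (creation k r i x))\<^sup>2
      = (\<Sum>w | length (w :: 'n list) \<le> k. case w of [] \<Rightarrow> 0
          | j # w' \<Rightarrow> if j = i then r\<^sup>2 * (cmod (x (to_nat w')))\<^sup>2 else 0)"
    unfolding hnorm_fin_hilbert_sq sum_fock_index creation_def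
    by (intro sum.cong) (auto split: list.splits simp: norm_mult power_mult_distrib)
  also have "\<dots> = (\<Sum>w | length (w :: 'n list) < k. r\<^sup>2 * (cmod (x (to_nat w)))\<^sup>2)"
    by (rule sum_words_Cons)
  also have "\<dots> \<le> (\<Sum>w | length (w :: 'n list) \<le> k. r\<^sup>2 * (cmod (x (to_nat w)))\<^sup>2)"
    by (rule sum_mono2) auto
  also have "\<dots> = (\<bar>r\<bar> * hnorm (fock TYPE('n) k) x)\<^sup>2"
    by (simp add: power_mult_distrib hnorm_fin_hilbert_sq sum_fock_index sum_distrib_left)
  finally show "(hnorm (fock TYPE('n) k) (creation k r i x))\<^sup>2
      \<le> (\<bar>r\<bar> * hnorm (fock TYPE('n) k) x)\<^sup>2" .
  show "0 \<le> \<bar>r\<bar> * hnorm (fock TYPE('n) k) x"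
    by (simp add: hnorm_fin_hilbert sum_nonneg)
qed

lemma creation_bounded_ops:
  fixes i :: "'n::finite"
  shows "creation k r i \<in> bounded_ops (fock TYPE('n) k)"
proof -
  interpret hilbert_space "fock TYPE('n) k"
    by (rule hilbert_space_fock)
  show ?thesis
  proof (rule bounded_opsI[where C = "\<bar>r\<bar>"])
    fix x y
    show "creation k r i (x \<oplus>\<^bsub>fock TYPE('n) k\<^esub> y)
        = creation k r i x \<oplus>\<^bsub>fock TYPE('n) k\<^esub> creation k r i y"
      unfolding fin_hilbert_simps creation_def fock_vec_def
      by (auto split: list.splits simp: algebra_simps)
  next
    fix c x
    show "creation k r i (c \<odot>\<^bsub>fock TYPE('n) k\<^esub> x) = c \<odot>\<^bsub>fock TYPE('n) k\<^esub> creation k r i x"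
      unfolding fin_hilbert_simps creation_def fock_vec_def
      by (auto split: list.splits)
  qed (rule creation_closed hnorm_creation_le)+
qed

text \<open>After the two sums are exchanged, a nonempty word contributes only for its own first
  letter and the empty word not at all, so the total is at most \<open>r\<^sup>2\<close> times the
  full squared norm.\<close>

lemma sum_annihilation_le:
  "(\<Sum>i\<in>UNIV. (hnorm (fock TYPE('n::finite) k) (annihilation k r (i :: 'n) y))\<^sup>2)
    \<le> r\<^sup>2 * (hnorm (fock TYPE('n) k) y)\<^sup>2"
proof -
  let ?g = "\<lambda>(w :: 'n list). r\<^sup>2 * (cmod (y (to_nat w)))\<^sup>2"
  have eq: "(hnorm (fock TYPE('n) k) (annihilation k r i y))\<^sup>2
      = (\<Sum>w | length w \<le> k. case w of [] \<Rightarrow> 0 | j # w' \<Rightarrow> if j = i then ?g (i # w') else 0)" for i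
  proof -
    have "(hnorm (fock TYPE('n) k) (annihilation k r i y))\<^sup>2
        = (\<Sum>w | length (w :: 'n list) \<le> k. if length w < k then ?g (i # w) else 0)"
      unfolding hnorm_fin_hilbert_sq sum_fock_index annihilation_def
      by (intro sum.cong) (auto simp: norm_mult power_mult_distrib)
    also have "\<dots> = (\<Sum>w | length w < k. ?g (i # w))"
      by (rule sum.mono_neutral_cong_right) auto
    finally show ?thesis
      by (simp only: sum_words_Cons)
  qed
  have "(\<Sum>i\<in>UNIV. (hnorm (fock TYPE('n) k) (annihilation k r (i :: 'n) y))\<^sup>2)
      = (\<Sum>w | length w \<le> k. \<Sum>i\<in>UNIV. case w of [] \<Rightarrow> 0 | j # w' \<Rightarrow> if j = i then ?g (i # w') else 0)"
    unfolding eq by (rule sum.swap)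
  also have "\<dots> \<le> (\<Sum>w | length w \<le> k. ?g w)"
  proof (rule sum_mono)
    fix w :: "'n list"
    show "(\<Sum>i\<in>UNIV. case w of [] \<Rightarrow> 0 | j # w' \<Rightarrow> if j = i then ?g (i # w') else 0) \<le> ?g w"
      by (cases w) auto
  qed
  also have "\<dots> = r\<^sup>2 * (hnorm (fock TYPE('n) k) y)\<^sup>2"
    by (simp add: hnorm_fin_hilbert_sq sum_fock_index sum_distrib_left)
  finally show ?thesis .
qed

lemma creation_row_ball:
  assumes "0 \<le> r" "r < 1"
  shows "(creation k r :: 'n::finite \<Rightarrow> _) \<in> row_ball (fock TYPE('n) k)"
proof -
  interpret hilbert_space "fock TYPE('n) k"
    by (rule hilbert_space_fock)
  have "op_norm (fock TYPE('n) k) (row_square (fock TYPE('n) k) (creation k r :: 'n \<Rightarrow> _)) \<le> r\<^sup>2"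
    by (rule op_norm_row_square_le)
      (simp_all only: adjoint_op_creation creation_bounded_ops sum_annihilation_le zero_le_power2)
  also have "r\<^sup>2 < 1"
    using assms by (simp add: power_less_one_iff abs_square_less_1)
  finally show ?thesis
    by (simp add: row_ball_def creation_bounded_ops)
qed

section \<open>The quadratic form of the series at the test vector\<close>

lemma creation_apply:
  "length w \<le> k \<Longrightarrow> creation k r (i :: 'n::finite) x (to_nat w)
    = (case w of [] \<Rightarrow> 0 | j # w' \<Rightarrow> if j = i then of_real r * x (to_nat w') else 0)"
  by (simp add: creation_def)

text \<open>The word operator prepends \<alpha>, so its output at \<open>w\<close> is read from
  \<open>w\<close> with the prefix \<alpha> removed. A word \<open>w\<close> shorter than \<alpha>
  fails the prefix test, as it should.\<close>

lemma word_op_creation: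
  assumes x: "x \<in> carrier (fock TYPE('n::finite) k)" and "length w \<le> k"
  shows "word_op (creation k r) (\<alpha> :: 'n list) x (to_nat w)
    = (if take (length \<alpha>) w = \<alpha> then of_real r ^ length \<alpha> * x (to_nat (drop (length \<alpha>) w)) else 0)"
  using assms(2)
proof (induction \<alpha> arbitrary: w)
  case (Cons i \<alpha>)
  have "word_op (creation k r) (i # \<alpha>) x = creation k r i (word_op (creation k r) \<alpha> x)"
    by (simp add: word_op_def)
  then show ?case
    using Cons by (cases w) (auto simp: creation_apply)
qed (simp add: word_op_def)

text \<open>The test vector is supported on lengths 0 and \<open>k\<close>, so prepending \<alpha>
  pairs nontrivially only if \<alpha> has one of these lengths. At length \<open>k\<close> it
  carries the empty word to \<alpha>, and the factor \<open>cnj (a \<alpha>)\<close> later meets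
  \<open>a \<alpha>\<close> from the series.\<close>

lemma cinner_word_op_creation:
  fixes a :: "'n::finite list \<Rightarrow> complex" and c r :: real and k :: nat
  defines "\<xi> \<equiv> \<lambda>w. if w = [] then of_real c else if length w = k then a w else 0"
  assumes k: "k \<ge> 1"
  shows "cinner (fock TYPE('n) k) (word_op (creation k r) \<alpha> (fock_vec k \<xi>)) (fock_vec k \<xi>)
    = (if \<alpha> = [] then of_real (c\<^sup>2 + (\<Sum>w | length w = k. (cmod (a w))\<^sup>2))
       else if length \<alpha> = k then of_real r ^ k * of_real c * cnj (a \<alpha>) else 0)"
    (is "?lhs = _")
proof -
  have split: "{w :: 'n list. w = [] \<or> length w = k} = insert [] {w. length w = k}"
    by auto
  have "?lhs = (\<Sum>w | length w \<le> k. (if take (length \<alpha>) w = \<alpha>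
      then of_real r ^ length \<alpha> * \<xi> (drop (length \<alpha>) w) else 0) * cnj (\<xi> w))"
    unfolding fin_hilbert_simps sum_fock_index
    by (intro sum.cong refl) (simp add: word_op_creation[OF fock_vec_closed])
  also have "\<dots> = (\<Sum>w | w = [] \<or> length w = k. (if take (length \<alpha>) w = \<alpha>
      then of_real r ^ length \<alpha> * \<xi> (drop (length \<alpha>) w) else 0) * cnj (\<xi> w))"
    by (rule sum.mono_neutral_right) (auto simp: \<xi>_def)
  also have "\<dots> = (if take (length \<alpha>) [] = \<alpha> then of_real r ^ length \<alpha> * \<xi> [] else 0) * cnj (\<xi> [])
      + (\<Sum>w | length w = k. (if take (length \<alpha>) w = \<alpha>
      then of_real r ^ length \<alpha> * \<xi> (drop (length \<alpha>) w) else 0) * cnj (\<xi> w))"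
    unfolding split using k by (subst sum.insert) auto
  also have "\<dots> = (if \<alpha> = [] then of_real (c\<^sup>2 + (\<Sum>w | length w = k. (cmod (a w))\<^sup>2))
       else if length \<alpha> = k then of_real r ^ k * of_real c * cnj (a \<alpha>) else 0)"
  proof -
    consider "\<alpha> = []" | "\<alpha> \<noteq> []" "length \<alpha> = k" | "\<alpha> \<noteq> []" "length \<alpha> \<noteq> k"
      by blast
    then show ?thesis
    proof cases
      case 1
      have "(\<Sum>w | length w = k. \<xi> w * cnj (\<xi> w)) = (\<Sum>w | length w = k. of_real ((cmod (a w))\<^sup>2))"
        by (rule sum.cong) (use k in \<open>auto simp: \<xi>_def complex_norm_square simp del: of_real_power\<close>)
      with 1 show ?thesis
        by (simp add: \<xi>_def power2_eq_square)
    next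
      case 2
      have "(\<Sum>w | length w = k. (if take (length \<alpha>) w = \<alpha>
          then of_real r ^ length \<alpha> * \<xi> (drop (length \<alpha>) w) else 0) * cnj (\<xi> w))
          = (\<Sum>w | length w = k. if w = \<alpha> then of_real r ^ k * of_real c * cnj (a w) else 0)"
        using 2 k by (intro sum.cong) (auto simp: \<xi>_def)
      with 2 show ?thesis
        by (simp add: sum.delta)
    next
      case 3
      have "(\<Sum>w | length w = k. (if take (length \<alpha>) w = \<alpha>
          then of_real r ^ length \<alpha> * \<xi> (drop (length \<alpha>) w) else 0) * cnj (\<xi> w)) = 0"
      proof (rule sum.neutral, rule ballI)
        fix w :: "'n list" assume w: "w \<in> {w. length w = k}"
        show "(if take (length \<alpha>) w = \<alpha>
          then of_real r ^ length \<alpha> * \<xi> (drop (length \<alpha>) w) else 0) * cnj (\<xi> w) = 0"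
        proof (cases "take (length \<alpha>) w = \<alpha>")
          case True
          \<comment> \<open>The suffix left after the prefix \<alpha> has length strictly between 0
            and \<open>k\<close>, where \<xi> vanishes.\<close>
          then have "length \<alpha> \<le> k"
            using w by (metis length_take mem_Collect_eq min.cobounded1)
          moreover have "length \<alpha> \<noteq> 0"
            using 3 by simp
          ultimately have "length (drop (length \<alpha>) w) \<noteq> 0" "length (drop (length \<alpha>) w) \<noteq> k"
            using 3(2) w k unfolding length_drop mem_Collect_eq by linarith+
          then have "\<xi> (drop (length \<alpha>) w) = 0"
            by (auto simp: \<xi>_def)
          then show ?thesis
            by simp
        qed simp
      qed
      with 3 show ?thesis
        by simp
    qed
  qed
  finally show ?thesis .
qed

text \<open>The real-part hypothesis evaluated at the scaled creation operators; \<open>r\<close>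
  stays below 1 because the hypothesis covers only the open ball.\<close>

lemma coefficient_form_le:
  fixes a :: "'n::finite list \<Rightarrow> complex" and c r :: real
  assumes hol: "free_holomorphic (fock TYPE('n) k) a"
    and le: "\<And>Z. Z \<in> row_ball (fock TYPE('n) k) \<Longrightarrow>
      op_le (fock TYPE('n) k) (Re_op (fock TYPE('n) k) (free_eval (fock TYPE('n) k) a Z)) id"
    and k: "k \<ge> 1" and r: "0 \<le> r" "r < 1"
  defines "B \<equiv> (\<Sum>w | length w = k. (cmod (a w))\<^sup>2)"
  shows "Re (a []) * (c\<^sup>2 + B) + r ^ k * c * B \<le> c\<^sup>2 + B"
proof -
  define H where "H = fock TYPE('n) k"
  interpret hilbert_space H
    unfolding H_def by (rule hilbert_space_fock)
  define Z where "Z = (creation k r :: 'n \<Rightarrow> _)"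
  define L where "L = free_eval H a Z"
  define x where "x = fock_vec k (\<lambda>w. if w = [] then of_real c else if length w = k then a w else 0)"
  have ball: "Z \<in> row_ball H"
    unfolding Z_def H_def using r by (rule creation_row_ball)
  then have Z: "\<And>i. Z i \<in> bounded_ops H"
    by (simp add: row_ball_def)
  have x: "x \<in> carrier H"
    unfolding x_def H_def by (rule fock_vec_closed)
  have "\<exists>L. free_series_sums H a Z L"
    using hol ball unfolding free_holomorphic_def H_def by blast
  \<comment> \<open>The choice in \<open>free_eval\<close> yields an actual sum of the series
    because holomorphy provides one.\<close>
  then have L: "free_series_sums H a Z L"
    unfolding L_def free_eval_def by (rule someI_ex)
  then have LB: "L \<in> bounded_ops H"
    by (simp add: free_series_sums_def)
  define h where "h m = (\<Sum>\<alpha> | length \<alpha> = m. a \<alpha> * cinner H (word_op Z \<alpha> x) x)" for m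
  have cin: "cinner H (word_op Z \<alpha> x) x = (if \<alpha> = [] then of_real (c\<^sup>2 + B)
       else if length \<alpha> = k then of_real r ^ k * of_real c * cnj (a \<alpha>) else 0)" for \<alpha>
    unfolding H_def Z_def x_def B_def by (rule cinner_word_op_creation[OF k])
  have h0: "h 0 = a [] * of_real (c\<^sup>2 + B)"
    by (simp add: h_def cin)
  have hk: "h k = of_real (r ^ k * c * B)"
  proof -
    have "h k = (\<Sum>\<alpha> | length \<alpha> = k. of_real (r ^ k * c) * of_real ((cmod (a \<alpha>))\<^sup>2))"
      unfolding h_def using k
      unfolding complex_norm_square by (intro sum.cong) (auto simp: cin)
    also have "\<dots> = of_real (r ^ k * c * B)"
      by (simp add: B_def sum_distrib_left)
    finally show ?thesis .
  qed
  \<comment> \<open>The series collapses to the terms of degree 0 and \<open>k\<close>, which are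
    distinct as \<open>k \<ge> 1\<close>.\<close>
  have h_other: "h m = 0" if "m \<notin> {0, k}" for m
    unfolding h_def using that by (intro sum.neutral) (auto simp: cin)
  have "h sums cinner H (L x) x"
    unfolding h_def using free_series_sums_tendsto[of Z, OF Z L x x] .
  moreover have "h sums (\<Sum>m\<in>{0, k}. h m)"
    by (rule sums_finite) (use h_other in auto)
  ultimately have "cinner H (L x) x = a [] * of_real (c\<^sup>2 + B) + of_real (r ^ k * c * B)"
    using k by (simp add: sums_unique2 h0 hk)
  then have "Re (cinner H (L x) x) = Re (a []) * (c\<^sup>2 + B) + r ^ k * c * B"
    by (simp flip: of_real_add of_real_mult of_real_power)
  moreover have "Re (cinner H x x) = c\<^sup>2 + B"
    using cin[of "[]"] by (simp add: word_op_def)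
  moreover have "Re (cinner H (L x) x) \<le> Re (cinner H x x)"
    using le[of Z] ball by (intro op_le_Re_op_id LB x) (simp add: L_def H_def)
  ultimately show ?thesis
    by simp
qed

lemma coefficient_bound:
  fixes a :: "'n::finite list \<Rightarrow> complex"
  assumes hol: "free_holomorphic (fock TYPE('n) k) a"
    and le: "\<And>Z. Z \<in> row_ball (fock TYPE('n) k) \<Longrightarrow>
      op_le (fock TYPE('n) k) (Re_op (fock TYPE('n) k) (free_eval (fock TYPE('n) k) a Z)) id"
    and k: "k \<ge> 1"
  shows "sqrt (\<Sum>\<alpha> | length \<alpha> = k. (cmod (a \<alpha>))\<^sup>2) \<le> 2 * (1 - Re (a []))"
proof -
  define B where "B = (\<Sum>\<alpha> | length \<alpha> = k. (cmod (a \<alpha>))\<^sup>2)"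
  define A where "A = sqrt B"
  have A: "A \<ge> 0" "B = A\<^sup>2"
    by (simp_all add: A_def B_def sum_nonneg)
  \<comment> \<open>The inequality is closed, so it survives the limit as \<open>r\<close> tends to
    1 from the left.\<close>
  have form: "Re (a []) * (c\<^sup>2 + B) + c * B \<le> c\<^sup>2 + B" for c
  proof (rule tendsto_upperbound)
    show "((\<lambda>r. Re (a []) * (c\<^sup>2 + B) + r ^ k * c * B) \<longlongrightarrow> Re (a []) * (c\<^sup>2 + B) + c * B) (at_left 1)"
      by (rule tendsto_eq_intros refl | simp)+
    have "\<forall>\<^sub>F r in at_left (1::real). r \<in> {0<..<1}"
      by (rule eventually_at_left_real) simp
    then show "\<forall>\<^sub>F r in at_left 1. Re (a []) * (c\<^sup>2 + B) + r ^ k * c * B \<le> c\<^sup>2 + B"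
    proof eventually_elim
      case (elim r)
      then show ?case
        using coefficient_form_le[OF hol le k, of r c] by (simp add: B_def)
    qed
  qed simp
  have "A \<le> 2 * (1 - Re (a []))"
  proof (cases "A = 0")
    case True
    then show ?thesis
      \<comment> \<open>With \<open>B = 0\<close> the choice \<open>c = A\<close> would be void;
        \<open>c = 1\<close> gives \<open>Re (a []) \<le> 1\<close>.\<close>
      using form[of 1] A(2) by simp
  next
    case False
    then have "A\<^sup>2 > 0"
      by simp
    \<comment> \<open>At \<open>c = A\<close> every term of the form contains the positive factor
      \<open>A\<^sup>2\<close>, which can be divided out.\<close>
    have "A\<^sup>2 * A \<le> A\<^sup>2 * (2 * (1 - Re (a [])))"
      using form[of A] A(2) by (simp add: algebra_simps)
    then show ?thesis
      using \<open>A\<^sup>2 > 0\<close> by (simp add: mult_le_cancel_left_pos)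
  qed
  then show ?thesis
    by (simp add: A_def B_def)
qed

section \<open>Summation over words\<close>

text \<open>Expanding the power without collecting equal monomials lists every word of length
  \<open>k\<close> once.\<close>

lemma sum_prod_list_words:
  fixes f :: "'n::finite \<Rightarrow> 'b::comm_semiring_1"
  shows "(\<Sum>\<alpha> | length \<alpha> = k. prod_list (map f \<alpha>)) = (\<Sum>i\<in>UNIV. f i) ^ k"
proof (induction k)
  case (Suc k)
  have "(\<Sum>\<alpha> | length \<alpha> = Suc k. prod_list (map f \<alpha>))
      = (\<Sum>i\<in>UNIV. f i * (\<Sum>\<alpha> | length \<alpha> = k. prod_list (map f \<alpha>)))"
    by (simp add: sum_words_Suc sum_distrib_left)
  then show ?case
    by (simp add: Suc sum_distrib_right)
qed simp

lemma prod_list_power2: "(prod_list xs)\<^sup>2 = prod_list (map (\<lambda>x. x\<^sup>2) xs)" for xs :: "real list"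
  by (induction xs) (auto simp: power_mult_distrib)

text \<open>Scalar counterpart of \<open>op_norm_homogeneous_part_le\<close>: the squares of the
  word products sum to a power of the squared Euclidean norm.\<close>

lemma sum_words_weighted_le:
  fixes r :: "real ^ 'n::finite" and c :: "'n list \<Rightarrow> real"
  shows "(\<Sum>\<alpha> | length \<alpha> = k. c \<alpha> * prod_list (map (\<lambda>i. r $ i) \<alpha>))
    \<le> sqrt (\<Sum>\<alpha> | length \<alpha> = k. (c \<alpha>)\<^sup>2) * norm r ^ k"
proof -
  have "(\<Sum>\<alpha> | length \<alpha> = k. (prod_list (map (\<lambda>i. r $ i) \<alpha>))\<^sup>2) = (\<Sum>i\<in>UNIV. (r $ i)\<^sup>2) ^ k"
    using sum_prod_list_words[of "\<lambda>i. (r $ i)\<^sup>2" k] by (simp add: prod_list_power2 o_def)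
  then have eq: "sqrt (\<Sum>\<alpha> | length \<alpha> = k. (prod_list (map (\<lambda>i. r $ i) \<alpha>))\<^sup>2) = norm r ^ k"
    by (simp add: norm_vec_def L2_set_def real_sqrt_power)
  show ?thesis
    using sum_mult_le_sqrt[of c "\<lambda>\<alpha>. prod_list (map (\<lambda>i. r $ i) \<alpha>)" "{\<alpha>. length \<alpha> = k}"]
    unfolding eq .
qed

lemma bohr_series_le_1:
  fixes b :: "nat \<Rightarrow> real"
  assumes nonneg: "\<And>k. 0 \<le> b k" and b0: "b 0 \<le> d" and "d \<le> 1"
    and le: "\<And>k. k \<ge> 1 \<Longrightarrow> b k \<le> 2 * (1 - d) * (1/3) ^ k"
  shows "summable b" "(\<Sum>k. b k) \<le> 1"
proof -
  \<comment> \<open>The majorant is geometric, with the term at 0 corrected from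
    \<open>2 * (1 - d)\<close> to \<open>d\<close>. Its sum is
    \<open>3 * (1 - d) + (3 * d - 2) = 1\<close>; the ratio 1/3 is what makes \<open>d\<close> drop
    out.\<close>
  define g where "g k = 2 * (1 - d) * (1/3) ^ k + (if k = 0 then 3 * d - 2 else 0)" for k :: nat
  have "(\<lambda>k. (1/3::real) ^ k) sums (3/2)"
    using geometric_sums[of "1/3::real"] by simp
  then have "(\<lambda>k. 2 * (1 - d) * (1/3) ^ k) sums (2 * (1 - d) * (3/2))"
    by (rule sums_mult)
  moreover have "(\<lambda>k. if k = 0 then 3 * d - 2 else 0 :: real) sums (3 * d - 2)"
    using sums_single[of 0 "\<lambda>_. 3 * d - 2"] by simp
  ultimately have "g sums (2 * (1 - d) * (3/2) + (3 * d - 2))"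
    unfolding g_def by (rule sums_add)
  then have g: "g sums 1"
    by (simp add: algebra_simps)
  have bg: "b k \<le> g k" for k
    using le[of k] b0 by (cases "k = 0") (auto simp: g_def)
  show s: "summable b"
    by (rule summable_comparison_test'[OF sums_summable[OF g], of 0]) (use nonneg bg in auto)
  show "(\<Sum>k. b k) \<le> 1"
    using suminf_le[OF bg s sums_summable[OF g]] sums_unique[OF g] by simp
qed

text \<open>A finite set of words meets only finitely many lengths, so each finite sum is at most a
  partial sum of the series by length; nonnegativity gives unordered summability.\<close>

lemma nonneg_summable_on_by_length:
  fixes f :: "'n::finite list \<Rightarrow> real"
  assumes nonneg: "\<And>\<alpha>. 0 \<le> f \<alpha>" and summ: "summable (\<lambda>k. \<Sum>\<alpha> | length \<alpha> = k. f \<alpha>)"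
  shows "f summable_on UNIV" "(\<Sum>\<^sub>\<infinity>\<alpha>. f \<alpha>) \<le> (\<Sum>k. \<Sum>\<alpha> | length \<alpha> = k. f \<alpha>)"
proof -
  let ?S = "\<Sum>k. \<Sum>\<alpha> | length \<alpha> = k. f \<alpha>"
  have bound: "sum f F \<le> ?S" if F: "finite F" for F
  proof -
    obtain N where N: "length ` F \<subseteq> {..<N}"
      using finite_nat_bounded[OF finite_imageI[OF F]] by blast
    have "sum f F \<le> sum f (\<Union>k<N. {\<alpha>. length \<alpha> = k})"
      using N nonneg by (intro sum_mono2) auto
    also have "\<dots> = (\<Sum>k<N. \<Sum>\<alpha> | length \<alpha> = k. f \<alpha>)"
      by (rule sum.UNION_disjoint) auto
    also have "\<dots> \<le> ?S"
      by (rule sum_le_suminf[OF summ]) (auto intro: sum_nonneg nonneg)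
    finally show ?thesis .
  qed
  show *: "f summable_on UNIV"
    by (rule nonneg_bdd_above_summable_on) (auto intro!: bdd_aboveI2[of _ _ ?S] bound nonneg)
  show "(\<Sum>\<^sub>\<infinity>\<alpha>. f \<alpha>) \<le> ?S"
    by (rule infsum_le_finite_sums[OF *]) (use bound in auto)
qed

text \<open>The two conditions on \<open>a []\<close> together express \<open>f(0) \<ge> 0\<close>.
  The hypotheses enter only through the scalar coefficient bound, which is why the operator
  conclusion reaches Hilbert spaces over an arbitrary carrier type \<open>'k\<close>. Summability is
  asserted beside each sum, since the value assigned to a divergent sum would carry no
  information.\<close>

theorem theorem1p4:
  fixes a :: "'n::finite list \<Rightarrow> complex"
  assumes "\<And>H :: universe hilbert. hilbert_space H \<Longrightarrow> free_holomorphic H a"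
    and "a [] \<in> \<real>" and "0 \<le> Re (a [])"
    and "\<And>(H :: universe hilbert) Z. hilbert_space H \<Longrightarrow> Z \<in> row_ball H \<Longrightarrow>
           op_le H (Re_op H (free_eval H a Z)) id"
  shows "(\<forall>k\<ge>1. sqrt (\<Sum>\<alpha> | length \<alpha> = k. (cmod (a \<alpha>))\<^sup>2) \<le> 2 * (1 - Re (a []))) \<and>
         (\<forall>(K :: 'k hilbert) T. hilbert_space K \<longrightarrow> T \<in> row_cball K (1/3) \<longrightarrow>
            summable (\<lambda>k. op_norm K (homogeneous_part K (\<lambda>\<alpha>. of_real (cmod (a \<alpha>))) T k)) \<and>
            (\<Sum>k. op_norm K (homogeneous_part K (\<lambda>\<alpha>. of_real (cmod (a \<alpha>))) T k)) \<le> 1) \<and>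
         (\<forall>r :: real ^ 'n. (\<forall>i. 0 \<le> r $ i) \<longrightarrow> norm r \<le> 1/3 \<longrightarrow>
            (\<lambda>\<alpha>. cmod (a \<alpha>) * prod_list (map (\<lambda>i. r $ i) \<alpha>)) summable_on UNIV \<and>
            (\<Sum>\<^sub>\<infinity>\<alpha>. cmod (a \<alpha>) * prod_list (map (\<lambda>i. r $ i) \<alpha>)) \<le> 1)"
proof -
  define C where "C k = sqrt (\<Sum>\<alpha> | length \<alpha> = k. (cmod (a \<alpha>))\<^sup>2)" for k
  define d where "d = Re (a [])"
  have C_le: "C k \<le> 2 * (1 - d)" if "k \<ge> 1" for k
    unfolding C_def d_def using that
    by (intro coefficient_bound assms hilbert_space_fock)
  have C_nonneg: "0 \<le> C k" for k
    by (simp add: C_def sum_nonneg)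
  \<comment> \<open>The only word of length 0 is empty, and the modulus of a nonnegative real is its
    real part.\<close>
  have C0: "C 0 = d"
    using assms(2,3) by (simp add: C_def d_def complex_is_Real_iff cmod_eq_Re)
  \<comment> \<open>The coefficient bound at length 1 forces its right-hand side to be
    nonnegative.\<close>
  have d: "d \<le> 1"
    using C_nonneg[of 1] C_le[of 1] by simp
  \<comment> \<open>Common to operators and scalars: \<open>q\<close> is the row norm in the one
    case and the Euclidean norm in the other.\<close>
  have geometric: "b k \<le> 2 * (1 - d) * (1/3) ^ k"
    if "\<And>k. b k \<le> C k * q ^ k" "0 \<le> q" "q \<le> 1/3" "k \<ge> 1" for b :: "nat \<Rightarrow> real" and q k
  proof -
    have "C k * q ^ k \<le> 2 * (1 - d) * (1/3) ^ k"
      using that d by (intro mult_mono C_le power_mono) auto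
    then show ?thesis
      using that(1)[of k] by linarith
  qed
  have b0: "b 0 \<le> d" if "\<And>k. b k \<le> C k * q ^ k" for b :: "nat \<Rightarrow> real" and q
    using that[of 0] by (simp add: C0)
  have operators: "summable (\<lambda>k. op_norm K (homogeneous_part K (\<lambda>\<alpha>. of_real (cmod (a \<alpha>))) T k)) \<and>
      (\<Sum>k. op_norm K (homogeneous_part K (\<lambda>\<alpha>. of_real (cmod (a \<alpha>))) T k)) \<le> 1"
    if K: "hilbert_space K" and T: "T \<in> row_cball K (1/3)" for K :: "'k hilbert" and T
  proof -
    interpret hilbert_space K
      by (rule K)
    define b where "b k = op_norm K (homogeneous_part K (\<lambda>\<alpha>. of_real (cmod (a \<alpha>))) T k)" for k
    define q where "q = sqrt (op_norm K (row_square K T))"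
    have TB: "\<And>i. T i \<in> bounded_ops K" and q: "q \<le> 1/3"
      using T by (auto simp: row_cball_def q_def)
    have q0: "0 \<le> q"
      unfolding q_def by (intro real_sqrt_ge_zero op_norm_nonneg row_square_bounded_ops TB)
    have "b k \<le> C k * q ^ k" for k
      using op_norm_homogeneous_part_le[of T "\<lambda>\<alpha>. of_real (cmod (a \<alpha>))" k, OF TB]
      by (simp add: b_def C_def q_def)
    note b = b0[OF this] geometric[OF this q0 q]
    have "0 \<le> b k" for k
      unfolding b_def by (intro op_norm_nonneg homogeneous_part_bounded_ops TB)
    from bohr_series_le_1[of b d, OF this b(1) d b(2)] show ?thesis
      unfolding b_def by blast
  qed
  have scalars: "(\<lambda>\<alpha>. cmod (a \<alpha>) * prod_list (map (\<lambda>i. r $ i) \<alpha>)) summable_on UNIV \<and>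
      (\<Sum>\<^sub>\<infinity>\<alpha>. cmod (a \<alpha>) * prod_list (map (\<lambda>i. r $ i) \<alpha>)) \<le> 1"
    if r: "\<forall>i. 0 \<le> r $ i" "norm r \<le> 1/3" for r :: "real ^ 'n"
  proof -
    define f where "f \<alpha> = cmod (a \<alpha>) * prod_list (map (\<lambda>i. r $ i) \<alpha>)" for \<alpha>
    define b where "b k = (\<Sum>\<alpha> | length \<alpha> = k. f \<alpha>)" for k
    have f: "0 \<le> f \<alpha>" for \<alpha>
      unfolding f_def using r(1) by (intro mult_nonneg_nonneg prod_list_nonneg) auto
    have "b k \<le> C k * norm r ^ k" for k
      unfolding b_def f_def C_def by (rule sum_words_weighted_le)
    note b = b0[OF this] geometric[OF this norm_ge_zero r(2)]
    have "0 \<le> b k" for k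
      unfolding b_def by (intro sum_nonneg f)
    note bohr = bohr_series_le_1[of b d, OF this b(1) d b(2)]
    have "f summable_on UNIV \<and> (\<Sum>\<^sub>\<infinity>\<alpha>. f \<alpha>) \<le> 1"
      using nonneg_summable_on_by_length[of f, OF f] bohr unfolding b_def by force
    then show ?thesis
      unfolding f_def .
  qed
  show ?thesis
    using C_le operators scalars unfolding C_def d_def by blast
qed

end
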